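(* Let $n\ge1$ and $\lambda>0$. (1) Let $k=\begin{pmatrix}P&Q\\ \bar Q&\bar P\end{pmatrix}\in S$. Then for all $z\in\mathbb C^n$ $$S_\lambda(\sigma(k))(z)=(\operatorname{Det}P)^{-1/2}\exp\left(\tfrac{\lambda}{4}\left(z(\bar QP^{-1}z)+2\bar z(P^{-1}-I_n)z-\bar z(P^{-1}Q\bar z)\right)\right).$$ (2) Let $X=\begin{pmatrix}A&B\\ \bar B&\bar A\end{pmatrix}\in\mathfrak s$. Then for all $z\in\mathbb C^n$ $$S_\lambda(d\sigma(X))(z)=-\tfrac12\operatorname{Tr}(A)+\tfrac{\lambda}{4}z(\bar Bz)-\tfrac{\lambda}{2}(Az)\bar z-\tfrac{\lambda}{4}\bar z(B\bar z).$$
   Context: For $z,w\in\mathbb C^n$, $zw:=\sum_{j=1}^n z_jw_j$ (bilinear); $|z|^2=z\bar z$. $S$ is the group of all matrices $k=\begin{pmatrix}P&Q\\ \bar Q&\bar P\end{pmatrix}$ with $P,Q\in M_n(\mathbb C)$, $PP^*-QQ^*=I_n$, $PQ^t=QP^t$. Its Lie algebra $\mathfrak s$ consists of the matrices $\begin{pmatrix}A&B\\ \bar B&\bar A\end{pmatrix}$ with $A^*=-A$, $B^t=B$. $\mathcal F_\lambda$ is the Hilbert space of holomorphic functions $f$ on $\mathbb C^n$ with $\|f\|^2=\int_{\mathbb C^n}|f(z)|^2e^{-\lambda|z|^2/2}\,d\mu_\lambda(z)<\infty$, $d\mu_\lambda(z)=(2\pi)^{-n}\lambda^n\,dm(z)$,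 $dm$ Lebesgue measure. Coherent states: $e_z(w)=\exp(\lambda\bar zw/2)$, so $f(z)=\langle f,e_z\rangle$. The Berezin symbol of an operator $A$ (whose domain contains the $e_z$) is $S_\lambda(A)(z)=\frac{(Ae_z)(z)}{\langle e_z,e_z\rangle}=\frac{\langle Ae_z,e_z\rangle}{\langle e_z,e_z\rangle}$. The kernel of $A$ is $k_A(z,w)=(Ae_w)(z)$, and $(Af)(z)=\int k_A(z,w)f(w)e^{-\lambda|w|^2/2}d\mu_\lambda(w)$. The metaplectic operator $\sigma(k)$, $k\in S$, is the operator on $\mathcal F_\lambda$ with kernel $$b_k(z,w)=(\operatorname{Det}P)^{-1/2}\exp\left(\tfrac{\lambda}{4}\left(z(\bar QP^{-1}z)+2(P^{-1}z)\bar w-\bar w(P^{-1}Q\bar w)\right)\right)$$ (principal square root, the same as in the claim). For $X\in\mathfrak s$, $d\sigma(X)$ is the differential of $\sigma$: $(d\sigma(X)f)(z)=\frac{d}{dt}\big|_{t=0}(\sigma(\exp tX)f)(z)$. *)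

theory Defs
  imports "HOL-Analysis.Analysis"
begin

definition bilin :: "complex^'n \<Rightarrow> complex^'n \<Rightarrow> complex" where
  "bilin z w = (\<Sum>j\<in>UNIV. z $ j * w $ j)"

definition vcnj :: "complex^'n \<Rightarrow> complex^'n" where
  "vcnj z = (\<chi> j. cnj (z $ j))"

abbreviation mcnj :: "complex^'n^'m \<Rightarrow> complex^'n^'m" where
  "mcnj \<equiv> map_matrix cnj"

definition adj :: "complex^'n^'m \<Rightarrow> complex^'m^'n" where
  "adj M = mcnj (transpose M)"

text \<open>The \<open>2n \<times> 2n\<close> matrices are indexed by the sum type \<open>'n + 'n\<close>; \<open>Inl\<close> stands for the
  first \<open>n\<close> coordinates and \<open>Inr\<close> for the last \<open>n\<close>.\<close>

definition block ::
  "complex^'n^'n \<Rightarrow> complex^'n^'n \<Rightarrow> complex^'n^'n \<Rightarrow> complex^'n^'n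
    \<Rightarrow> complex^('n + 'n)^('n + 'n)" where
  "block A B C D = (\<chi> i j.
     (case i of
        Inl p \<Rightarrow> (case j of Inl q \<Rightarrow> A $ p $ q | Inr q \<Rightarrow> B $ p $ q)
      | Inr p \<Rightarrow> (case j of Inl q \<Rightarrow> C $ p $ q | Inr q \<Rightarrow> D $ p $ q)))"

definition upper_left :: "complex^('n::finite + 'n)^('n + 'n) \<Rightarrow> complex^'n^'n" where
  "upper_left k = (\<chi> i j. k $ Inl i $ Inl j)"

definition upper_right :: "complex^('n::finite + 'n)^('n + 'n) \<Rightarrow> complex^'n^'n" where
  "upper_right k = (\<chi> i j. k $ Inl i $ Inr j)"

text \<open>The library's product \<open>*\<close> on the type of vectors is componentwise, so that \<open>exp\<close> is not
  available for square matrices; the powers below are those of the matrix product.\<close>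

definition mexp :: "complex^'m^'m \<Rightarrow> complex^'m^'m" where
  "mexp M = (\<Sum>k. (1 / fact k) *\<^sub>R (((\<lambda>N. M ** N) ^^ k) (mat 1)))"

definition group_S :: "(complex^('n::finite + 'n)^('n + 'n)) set" where
  "group_S = {block P Q (mcnj Q) (mcnj P) | P Q.
     P ** adj P - Q ** adj Q = mat 1 \<and> P ** transpose Q = Q ** transpose P}"

definition algebra_s :: "(complex^('n::finite + 'n)^('n + 'n)) set" where
  "algebra_s = {block A B (mcnj B) (mcnj A) | A B. adj A = - A \<and> transpose B = B}"

text \<open>Holomorphy in several variables: the Frechet derivative exists everywhere and is
  complex linear.\<close>

definition entire :: "(complex^'n \<Rightarrow> complex) \<Rightarrow> bool" where
  "entire f \<longleftrightarrow>
     (\<forall>z. \<exists>D. (f has_derivative D) (at z) \<and> (\<forall>c v. D (c *s v) = c * D v))"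

definition mu :: "real \<Rightarrow> (complex^'n) measure" where
  "mu lam = density lborel (\<lambda>_. ennreal (lam ^ CARD('n) / (2 * pi) ^ CARD('n)))"

definition fock :: "real \<Rightarrow> (complex^'n \<Rightarrow> complex) set" where
  "fock lam = {f. entire f \<and>
     integrable (mu lam) (\<lambda>z. (norm (f z))\<^sup>2 * exp (- lam * (norm z)\<^sup>2 / 2))}"

definition fock_inner ::
  "real \<Rightarrow> (complex^'n \<Rightarrow> complex) \<Rightarrow> (complex^'n \<Rightarrow> complex) \<Rightarrow> complex" where
  "fock_inner lam f g =
     (\<integral>z. f z * cnj (g z) * of_real (exp (- lam * (norm z)\<^sup>2 / 2)) \<partial>mu lam)"

definition coherent :: "real \<Rightarrow> complex^'n \<Rightarrow> complex^'n \<Rightarrow> complex" where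
  "coherent lam z = (\<lambda>w. exp (of_real lam * bilin (vcnj z) w / 2))"

text \<open>An operator on the Fock space is given by its action, a function \<open>A\<close> on functions, and
  by a domain, a subset of \<open>fock lam\<close>; the symbol is meaningful when the domain contains all
  coherent states. If \<open>A (coherent lam z)\<close> lies in \<open>fock lam\<close>, the numerator is
  \<open>fock_inner lam (A (coherent lam z)) (coherent lam z)\<close> by the reproducing property.\<close>

definition berezin ::
  "real \<Rightarrow> ((complex^'n \<Rightarrow> complex) \<Rightarrow> (complex^'n \<Rightarrow> complex)) \<Rightarrow> complex^'n \<Rightarrow> complex" where
  "berezin lam A z =
     A (coherent lam z) z / fock_inner lam (coherent lam z) (coherent lam z)"

definition kernel_integrand ::
  "real \<Rightarrow> (complex^'n \<Rightarrow> complex^'n \<Rightarrow> complex) \<Rightarrow> (complex^'n \<Rightarrow> complex)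
    \<Rightarrow> complex^'n \<Rightarrow> complex^'n \<Rightarrow> complex" where
  "kernel_integrand lam b f z w = b z w * f w * of_real (exp (- lam * (norm w)\<^sup>2 / 2))"

definition kernel_op ::
  "real \<Rightarrow> (complex^'n \<Rightarrow> complex^'n \<Rightarrow> complex) \<Rightarrow> (complex^'n \<Rightarrow> complex)
    \<Rightarrow> complex^'n \<Rightarrow> complex" where
  "kernel_op lam b f = (\<lambda>z. \<integral>w. kernel_integrand lam b f z w \<partial>mu lam)"

definition kernel_dom ::
  "real \<Rightarrow> (complex^'n \<Rightarrow> complex^'n \<Rightarrow> complex) \<Rightarrow> (complex^'n \<Rightarrow> complex) set" where
  "kernel_dom lam b = {f \<in> fock lam.
     (\<forall>z. integrable (mu lam) (kernel_integrand lam b f z)) \<and> kernel_op lam b f \<in> fock lam}"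

definition metaplectic_kernel ::
  "real \<Rightarrow> complex^('n::finite + 'n)^('n + 'n) \<Rightarrow> complex^'n \<Rightarrow> complex^'n \<Rightarrow> complex" where
  "metaplectic_kernel lam k z w =
     (let P = upper_left k; Q = upper_right k; R = matrix_inv P in
      inverse (csqrt (det P)) *
      exp (of_real lam / 4 *
        (bilin z ((mcnj Q ** R) *v z)
         + 2 * bilin (R *v z) (vcnj w)
         - bilin (vcnj w) ((R ** Q) *v vcnj w))))"

definition metaplectic ::
  "real \<Rightarrow> complex^('n::finite + 'n)^('n + 'n) \<Rightarrow> (complex^'n \<Rightarrow> complex) \<Rightarrow> complex^'n \<Rightarrow> complex" where
  "metaplectic lam k = kernel_op lam (metaplectic_kernel lam k)"

definition metaplectic_dom ::
  "real \<Rightarrow> complex^('n::finite + 'n)^('n + 'n) \<Rightarrow> (complex^'n \<Rightarrow> complex) set" where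
  "metaplectic_dom lam k = kernel_dom lam (metaplectic_kernel lam k)"

definition metaplectic_diff ::
  "real \<Rightarrow> complex^('n::finite + 'n)^('n + 'n) \<Rightarrow> (complex^'n \<Rightarrow> complex) \<Rightarrow> complex^'n \<Rightarrow> complex" where
  "metaplectic_diff lam X f =
     (\<lambda>z. vector_derivative (\<lambda>t::real. metaplectic lam (mexp (t *\<^sub>R X)) f z) (at 0))"

definition metaplectic_diff_dom ::
  "real \<Rightarrow> complex^('n::finite + 'n)^('n + 'n) \<Rightarrow> (complex^'n \<Rightarrow> complex) set" where
  "metaplectic_diff_dom lam X = {f \<in> fock lam.
     (\<forall>t::real. f \<in> metaplectic_dom lam (mexp (t *\<^sub>R X))) \<and>
     (\<forall>z. (\<lambda>t::real. metaplectic lam (mexp (t *\<^sub>R X)) f z) differentiable (at 0)) \<and>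
     metaplectic_diff lam X f \<in> fock lam}"

end

(* The conjugate kernel w |-> cnj (b_k(z,w)) is an entire function, so pairing it with a coherent
   state evaluates it: sigma(k) e_w = b_k(., w), and the symbol of sigma(k) is b_k(z,z) divided by
   <e_z,e_z>. The integrals converge because k being in S makes conj(Q) P^-1 and P^-1 Q strict
   contractions. The reproducing property is the mean value property of entire functions:
   translate by w, then average over u |-> exp(i theta) u, which preserves the Gaussian measure.
   For the second part, exp(tX) stays in S because it preserves both the conjugation symmetry
   and the Hermitian form diag(1,-1); the symbol of d sigma(X) is then obtained by
   differentiating b_exp(tX)(z,w) at t = 0, where P' = A, Q' = B and (P^-1)' = -A. *)
theory Submission
  imports Defs "HOL-Probability.Distributions" "HOL-Complex_Analysis.Cauchy_Integral_Formula"
begin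

subsection \<open>Rotation invariance and the Gaussian mean value property\<close>

text \<open>One growth class carries the analysis: bounds
  \<open>C * exp (c * (norm z)\<^sup>2)\<close> with a strict gap above \<open>c\<close>. A rate
  below \<open>lam / 4\<close> puts an entire function into the Fock space, a rate below
  \<open>lam / 2\<close> suffices for the reproducing property, and linear exponents or polynomial
  factors cost an arbitrarily small part of the gap. The gap itself comes from an isometry: with
  \<open>R\<close> the inverse of \<open>P\<close>, the squared norms of
  \<open>(mcnj Q ** R) *v v\<close> and \<open>R *v v\<close> add up to that of \<open>v\<close>,
  and \<open>R *v v\<close> cannot be small because \<open>P\<close> is bounded. The same isometry
  bounds the entries of \<open>R\<close> uniformly along \<open>exp (t X)\<close>, from which
  differentiability of the inverse at 0 follows. The principal square root need not be continuous
  along this whole curve; the derivative is taken at 0, where \<open>det P = 1\<close> stays away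
  from the branch cut. Since the domains are part of the claim, the images of coherent states are
  identified as functions of \<open>z\<close> for each fixed \<open>w\<close>; the diagonal
  \<open>z = w\<close> is taken at the very end.\<close>

lemma nn_integral_lborel_plus:
  fixes f :: "'a::euclidean_space \<Rightarrow> ennreal"
  assumes [measurable]: "f \<in> borel_measurable borel"
  shows "(\<integral>\<^sup>+x. f (c + x) \<partial>lborel) = (\<integral>\<^sup>+x. f x \<partial>lborel)"
  by (subst (2) lborel_distr_plus[of c, symmetric]) (simp add: nn_integral_distr)

text \<open>The integral of \<open>f (T x + y) * g y\<close> over all \<open>(x, y)\<close>, with \<open>g\<close> the indicator of the unit
  ball, is computed in both orders; it only uses that \<open>T\<close> preserves the ball.\<close>

lemma nn_integral_lborel_orthogonal:
  fixes T :: "'a::euclidean_space \<Rightarrow> 'a" and f :: "'a \<Rightarrow> ennreal"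
  assumes T: "orthogonal_transformation T" and [measurable]: "f \<in> borel_measurable borel"
  shows "(\<integral>\<^sup>+x. f (T x) \<partial>lborel) = (\<integral>\<^sup>+x. f x \<partial>lborel)"
proof -
  define B where "B = ball (0::'a) 1"
  have [measurable]: "B \<in> sets borel" by (simp add: B_def)
  let ?g = "indicator B :: 'a \<Rightarrow> ennreal"
  have lin: "linear T" using T by (rule orthogonal_transformation_linear)
  have [measurable]: "T \<in> borel_measurable borel"
    using lin by (intro borel_measurable_continuous_onI linear_continuous_on) (simp add: linear_linear)
  have surj: "surj T" using T by (rule orthogonal_transformation_surj)
  have g: "?g (- T x) = ?g x" for x
    using T by (simp add: indicator_def B_def orthogonal_transformation_norm)
  have "(\<integral>\<^sup>+x. f (T x) \<partial>lborel) * emeasure lborel B = (\<integral>\<^sup>+y. (\<integral>\<^sup>+x. f (T x) \<partial>lborel) * ?g y \<partial>lborel)"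
    by (rule nn_integral_cmult_indicator[symmetric]) simp
  also have "\<dots> = (\<integral>\<^sup>+y. (\<integral>\<^sup>+x. f (T x + y) * ?g y \<partial>lborel) \<partial>lborel)"
  proof (rule nn_integral_cong)
    fix y :: 'a
    \<comment> \<open>By linearity, translating by \<open>y\<close> after \<open>T\<close> is
      translating by its preimage \<open>c\<close> before \<open>T\<close>, so translation
      invariance applies.\<close>
    obtain c where c: "y = T c" using surj by (metis surjD)
    have "(\<integral>\<^sup>+x. f (T x) \<partial>lborel) = (\<integral>\<^sup>+x. f (T (c + x)) \<partial>lborel)"
      by (rule nn_integral_lborel_plus[symmetric, of "\<lambda>x. f (T x)"]) simp
    also have "\<dots> = (\<integral>\<^sup>+x. f (T x + y) \<partial>lborel)"
      by (simp add: c linear_add[OF lin] add.commute)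
    finally show "(\<integral>\<^sup>+x. f (T x) \<partial>lborel) * ?g y = (\<integral>\<^sup>+x. f (T x + y) * ?g y \<partial>lborel)"
      by (simp add: nn_integral_multc)
  qed
  also have "\<dots> = (\<integral>\<^sup>+x. (\<integral>\<^sup>+y. f (T x + y) * ?g y \<partial>lborel) \<partial>lborel)"
    by (rule lborel_pair.Fubini') measurable
  also have "\<dots> = (\<integral>\<^sup>+x. (\<integral>\<^sup>+y. f y * ?g (y - T x) \<partial>lborel) \<partial>lborel)"
  proof (rule nn_integral_cong)
    fix x :: 'a
    show "(\<integral>\<^sup>+y. f (T x + y) * ?g y \<partial>lborel) = (\<integral>\<^sup>+y. f y * ?g (y - T x) \<partial>lborel)"
      using nn_integral_lborel_plus[of "\<lambda>y. f y * ?g (y - T x)" "T x"] by simp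
  qed
  also have "\<dots> = (\<integral>\<^sup>+y. (\<integral>\<^sup>+x. f y * ?g (y - T x) \<partial>lborel) \<partial>lborel)"
    by (rule lborel_pair.Fubini'[symmetric]) measurable
  also have "\<dots> = (\<integral>\<^sup>+y. f y * emeasure lborel B \<partial>lborel)"
  proof (rule nn_integral_cong)
    fix y :: 'a
    \<comment> \<open>Replacing \<open>x\<close> by \<open>c + x\<close> turns
      \<open>y - T x\<close> into \<open>- T x\<close>; the ball is invariant under \<open>T\<close>
      and under negation, so its volume is left.\<close>
    obtain c where c: "y = T c" using surj by (metis surjD)
    have "(\<integral>\<^sup>+x. ?g (y - T x) \<partial>lborel) = (\<integral>\<^sup>+x. ?g (y - T (c + x)) \<partial>lborel)"
      by (rule nn_integral_lborel_plus[symmetric, of "\<lambda>x. ?g (y - T x)"]) measurable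
    also have "\<dots> = (\<integral>\<^sup>+x. ?g x \<partial>lborel)"
      by (simp add: c linear_add[OF lin] g del: indicator_simps)
    finally show "(\<integral>\<^sup>+x. f y * ?g (y - T x) \<partial>lborel) = f y * emeasure lborel B"
      by (simp add: nn_integral_cmult)
  qed
  also have "\<dots> = (\<integral>\<^sup>+x. f x \<partial>lborel) * emeasure lborel B"
    by (simp add: nn_integral_multc)
  finally have eq: "(\<integral>\<^sup>+x. f (T x) \<partial>lborel) * emeasure lborel B = (\<integral>\<^sup>+x. f x \<partial>lborel) * emeasure lborel B" .
  \<comment> \<open>Cancelling the volume of the ball in \<open>ennreal\<close> requires it to be
    finite and nonzero.\<close>
  have fin: "emeasure lborel B < \<infinity>" unfolding B_def by (rule emeasure_lborel_ball_finite)
  have pos: "emeasure lborel B \<noteq> 0"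
  proof
    assume "emeasure lborel B = 0"
    hence "negligible B" by (simp add: negligible_iff_null_sets null_sets_def null_sets_completionI)
    thus False by (simp add: B_def open_not_negligible)
  qed
  show ?thesis
    using eq fin pos ennreal_mult_cancel_left[of "emeasure lborel B" "\<integral>\<^sup>+x. f (T x) \<partial>lborel" "\<integral>\<^sup>+x. f x \<partial>lborel"]
    by (auto simp: mult.commute)
qed

text \<open>Equality of image measures transfers Bochner integrals too, and the integrands to be
  rotated later are complex-valued.\<close>

lemma distr_lborel_orthogonal:
  fixes T :: "'a::euclidean_space \<Rightarrow> 'a"
  assumes T: "orthogonal_transformation T"
  shows "distr lborel borel T = lborel"
proof (rule measure_eqI)
  have [measurable]: "T \<in> borel_measurable borel"
    using orthogonal_transformation_linear[OF T]
    by (intro borel_measurable_continuous_onI linear_continuous_on) (simp add: linear_linear)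
  fix A assume "A \<in> sets (distr lborel borel T)"
  hence [measurable]: "A \<in> sets borel" by simp
  have "emeasure (distr lborel borel T) A = (\<integral>\<^sup>+x. indicator A x \<partial>distr lborel borel T)" by simp
  also have "\<dots> = (\<integral>\<^sup>+x. indicator A (T x) \<partial>lborel)" by (subst nn_integral_distr) measurable
  also have "\<dots> = (\<integral>\<^sup>+x. indicator A x \<partial>lborel)" by (rule nn_integral_lborel_orthogonal[OF T]) measurable
  finally show "emeasure (distr lborel borel T) A = emeasure lborel A" by simp
qed simp

section \<open>Gaussian integrals in one and several dimensions\<close>

lemma nn_integral_gaussian_real:
  fixes a :: real assumes "a > 0"
  shows "(\<integral>\<^sup>+x. ennreal (exp (- a * x\<^sup>2)) \<partial>lborel) = ennreal (sqrt (pi / a))"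
proof -
  \<comment> \<open>The standard deviation for which the exponent
    \<open>- x\<^sup>2 / (2 * s\<^sup>2)\<close> of the normal density becomes
    \<open>- a * x\<^sup>2\<close>.\<close>
  define s where "s = sqrt (1 / (2 * a))"
  have s: "s > 0" "s\<^sup>2 = 1 / (2 * a)" using assms by (auto simp: s_def)
  have eq: "exp (- a * x\<^sup>2) = sqrt (pi / a) * normal_density 0 s x" for x
    using assms s by (simp add: normal_density_def real_sqrt_divide)
  have "(\<integral>\<^sup>+x. ennreal (exp (- a * x\<^sup>2)) \<partial>lborel)
      = (\<integral>\<^sup>+x. ennreal (sqrt (pi / a)) * ennreal (normal_density 0 s x) \<partial>lborel)"
    using assms by (intro nn_integral_cong) (simp only: eq, simp add: ennreal_mult)
  also have "\<dots> = ennreal (sqrt (pi / a)) * (\<integral>\<^sup>+x. ennreal (normal_density 0 s x) \<partial>lborel)"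
    by (rule nn_integral_cmult) simp
  also have "(\<integral>\<^sup>+x. ennreal (normal_density 0 s x) \<partial>lborel) = 1"
    using s by (simp add: nn_integral_eq_integral integrable_normal_density integral_normal_density)
  finally show ?thesis by simp
qed

lemma nn_integral_gaussian:
  fixes a :: real assumes a: "a > 0"
  shows "(\<integral>\<^sup>+x. ennreal (exp (- a * (norm x)\<^sup>2)) \<partial>(lborel :: 'a::euclidean_space measure))
    = ennreal (sqrt (pi / a) ^ DIM('a))"
proof -
  have "(\<integral>\<^sup>+x. ennreal (exp (- a * (norm x)\<^sup>2)) \<partial>(lborel :: 'a measure))
      = (\<integral>\<^sup>+x. (\<Prod>b\<in>Basis. ennreal (exp (- a * (x \<bullet> b)\<^sup>2))) \<partial>(lborel :: 'a measure))"
  proof (rule nn_integral_cong)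
    fix x :: 'a
    have "(norm x)\<^sup>2 = (\<Sum>b\<in>Basis. (x \<bullet> b)\<^sup>2)"
      by (subst power2_norm_eq_inner, subst euclidean_inner) (simp add: power2_eq_square)
    hence "exp (- a * (norm x)\<^sup>2) = (\<Prod>b\<in>Basis. exp (- a * (x \<bullet> b)\<^sup>2))"
      by (simp add: exp_sum sum_distrib_left sum_negf flip: exp_sum)
    thus "ennreal (exp (- a * (norm x)\<^sup>2)) = (\<Prod>b\<in>Basis. ennreal (exp (- a * (x \<bullet> b)\<^sup>2)))"
      by (simp add: prod_ennreal)
  qed
  also have "\<dots> = (\<Prod>b\<in>(Basis::'a set). ennreal (sqrt (pi / a)))"
    using nn_integral_lborel_prod[of "\<lambda>b x. ennreal (exp (- a * x\<^sup>2))"]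
    by (simp add: nn_integral_gaussian_real[OF a, simplified])
  also have "\<dots> = ennreal (sqrt (pi / a) ^ DIM('a))"
    using a by (simp add: prod_ennreal ennreal_power)
  finally show ?thesis .
qed

lemma has_bochner_integral_gaussian:
  fixes a :: real assumes a: "a > 0"
  shows "has_bochner_integral (lborel :: 'a::euclidean_space measure)
    (\<lambda>x. exp (- a * (norm x)\<^sup>2)) (sqrt (pi / a) ^ DIM('a))"
  using a by (intro has_bochner_integral_nn_integral nn_integral_gaussian) auto

lemma integrable_gaussian:
  fixes a :: real assumes a: "a > 0"
  shows "integrable (lborel :: 'a::euclidean_space measure) (\<lambda>x. exp (- a * (norm x)\<^sup>2))"
  using has_bochner_integral_gaussian[OF a, where 'a='a] by (simp add: has_bochner_integral_iff)

lemma integrable_gaussian_bound: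
  fixes f :: "'a::euclidean_space \<Rightarrow> 'b::{banach, second_countable_topology}"
  assumes "f \<in> borel_measurable borel" "a > 0" "\<And>x. norm (f x) \<le> C * exp (- a * (norm x)\<^sup>2)"
  shows "integrable lborel f"
  by (rule Bochner_Integration.integrable_bound[OF integrable_mult_right[OF integrable_gaussian[OF assms(2)], of C]])
    (use assms in \<open>auto intro!: AE_I2 intro: order_trans[OF assms(3)]\<close>)

text \<open>Cauchy's formula for the centre of the unit circle: in the parametrisation by
  \<open>exp (2 pi i t)\<close> the factor \<open>1 / u\<close> cancels against \<open>du\<close>,
  leaving a constant \<open>2 pi i\<close> to be divided out.\<close>

lemma entire_circle_average:
  assumes "f holomorphic_on UNIV"
  shows "((\<lambda>t. f (exp (2 * of_real pi * \<i> * of_real t))) has_integral f 0) {0..1::real}"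
proof -
  have "((\<lambda>u. f u / (u - 0)) has_contour_integral 2 * of_real pi * \<i> * f 0) (circlepath 0 1)"
    using assms by (intro Cauchy_integral_circlepath_simple) (auto intro: holomorphic_on_subset)
  hence "((\<lambda>t. f (circlepath 0 1 t) / circlepath 0 1 t * (2 * pi * \<i> * exp (2 * of_real pi * \<i> * t)))
      has_integral 2 * of_real pi * \<i> * f 0) {0..1}"
    unfolding has_contour_integral_def
    by (rule has_integral_eq[rotated]) (simp add: vector_derivative_circlepath01)
  moreover define k where "k = 2 * of_real pi * \<i>"
  ultimately have "((\<lambda>t. k * f (exp (2 * of_real pi * \<i> * of_real t))) has_integral k * f 0) {0..1}"
    by (auto simp: circlepath mult_ac elim!: has_integral_eq[rotated])
  hence "((\<lambda>t. inverse k * (k * f (exp (2 * of_real pi * \<i> * of_real t)))) has_integral inverse k * (k * f 0)) {0..1}"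
    by (rule has_integral_mult_right)
  moreover have "k \<noteq> 0" by (simp add: k_def)
  hence "inverse k * (k * x) = x" for x by (simp flip: mult.assoc)
  ultimately show ?thesis by simp
qed

lemma norm_smult_vec: "norm (c *s (u :: complex^'n)) = cmod c * norm u"
  by (simp add: norm_vec_def L2_set_def norm_mult power_mult_distrib real_sqrt_mult flip: sum_distrib_left)

lemma orthogonal_transformation_phase:
  assumes "cmod c = 1"
  shows "orthogonal_transformation (\<lambda>u :: complex^'n. c *s u)"
  unfolding orthogonal_transformation
  by (auto intro!: linearI simp: norm_smult_vec assms vector_add_ldistrib vec_eq_iff scaleR_conv_of_real mult_ac)

text \<open>For every direction \<open>u\<close> the circle average of
  \<open>c |-> F (c *s u)\<close> is \<open>F 0\<close>, while the weight depends on
  \<open>norm u\<close> alone and comes out of the average. The gap \<open>c < a\<close> leaves a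
  Gaussian majorant, which permits exchanging the average with the integral.\<close>

lemma gaussian_mean_value:
  fixes F :: "complex^'n \<Rightarrow> complex"
  assumes hol: "\<And>u. (\<lambda>c. F (c *s u)) holomorphic_on UNIV"
    and cont: "continuous_on UNIV F"
    and bound: "\<And>u. norm (F u) \<le> C * exp (c * (norm u)\<^sup>2)" and "c < a"
  shows "(\<integral>u. F u * of_real (exp (- a * (norm u)\<^sup>2)) \<partial>lborel)
    = F 0 * of_real (\<integral>u. exp (- a * (norm u)\<^sup>2) \<partial>(lborel :: (complex^'n) measure))"
proof -
  define e where "e t = exp (2 * of_real pi * \<i> * of_real t)" for t :: real
  define G where "G u = F u * of_real (exp (- a * (norm u)\<^sup>2))" for u
  have ne: "cmod (e t) = 1" for t by (simp add: e_def)
  have C: "C \<ge> 0" using order_trans[OF norm_ge_zero bound[of 0]] by simp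
  have conte: "continuous_on UNIV e" unfolding e_def by (intro continuous_intros)
  have [measurable]: "e \<in> borel_measurable borel"
    using conte by (rule borel_measurable_continuous_onI)
  have contG: "continuous_on UNIV G" unfolding G_def by (intro continuous_intros cont)
  have [measurable]: "G \<in> borel_measurable borel"
    using contG by (rule borel_measurable_continuous_onI)
  have contm: "continuous_on UNIV (\<lambda>p :: real \<times> (complex^'n). e (fst p) *s snd p)"
    unfolding vector_scalar_mult_def
    by (intro continuous_intros continuous_on_compose2[OF conte]) auto
  have Gm: "(\<lambda>p. G (e (fst p) *s snd p)) \<in> borel_measurable borel"
    by (intro borel_measurable_continuous_onI continuous_on_compose2[OF contG contm]) auto
  have Gb: "norm (G u) \<le> C * exp (- (a - c) * (norm u)\<^sup>2)" for u
  proof -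
    have "norm (G u) \<le> C * exp (c * (norm u)\<^sup>2) * exp (- a * (norm u)\<^sup>2)"
      unfolding G_def norm_mult using bound[of u] by (simp add: mult_right_mono)
    thus ?thesis by (simp add: algebra_simps flip: exp_add)
  qed
  have rot: "(\<integral>u. G (e t *s u) \<partial>lborel) = (\<integral>u. G u \<partial>lborel)" for t
  proof -
    have T: "orthogonal_transformation (\<lambda>u :: complex^'n. e t *s u)"
      by (rule orthogonal_transformation_phase[OF ne])
    have [measurable]: "(\<lambda>u :: complex^'n. e t *s u) \<in> borel_measurable borel"
      unfolding vector_scalar_mult_def by (intro borel_measurable_continuous_onI continuous_intros)
    show ?thesis
      by (subst (2) distr_lborel_orthogonal[OF T, symmetric]) (simp add: integral_distr)
  qed
  \<comment> \<open>The indicator extends the average over \<open>{0..1}\<close> to the whole line,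
    so that Fubini applies to a product of two Lebesgue measures.\<close>
  let ?H = "\<lambda>(t, u). indicator {0..1} t *\<^sub>R G (e t *s u)"
  have "integrable (lborel \<Otimes>\<^sub>M lborel) ?H"
  proof (rule Bochner_Integration.integrable_bound)
    show "integrable (lborel \<Otimes>\<^sub>M lborel)
        (\<lambda>(t :: real, u :: complex^'n). indicator {0..1} t * (C * exp (- (a - c) * (norm u)\<^sup>2)))"
      (is "integrable _ ?K")
    proof (rule lborel_pair.Fubini_integrable)
      have i: "integrable lborel (\<lambda>u :: complex^'n. C * exp (- (a - c) * (norm u)\<^sup>2))"
        using \<open>c < a\<close> by (intro integrable_mult_right integrable_gaussian) auto
      show "integrable lborel (\<lambda>t. \<integral>u. norm (?K (t, u)) \<partial>lborel)"
        using C by (simp add: abs_mult)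
      show "AE t in lborel. integrable lborel (\<lambda>u. ?K (t, u))"
        using integrable_mult_right[OF i] by (intro AE_I2) simp
      show "?K \<in> borel_measurable (lborel \<Otimes>\<^sub>M lborel)"
        by measurable
    qed
    show "?H \<in> borel_measurable (lborel \<Otimes>\<^sub>M lborel)"
      unfolding case_prod_beta
    proof (rule borel_measurable_scaleR)
      show "(\<lambda>p. G (e (fst p) *s snd p)) \<in> borel_measurable (lborel \<Otimes>\<^sub>M lborel)"
        using Gm by (simp add: lborel_prod)
    qed measurable
    show "AE x in lborel \<Otimes>\<^sub>M lborel. norm (?H x)
        \<le> norm (case x of (t, u) \<Rightarrow> indicator {0..1} t * (C * exp (- (a - c) * (norm u)\<^sup>2)))"
    proof (rule AE_I2, clarify)
      fix t :: real and u :: "complex^'n"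
      have "norm (G (e t *s u)) \<le> C * exp (- (a - c) * (norm u)\<^sup>2)"
        using Gb[of "e t *s u"] by (simp add: norm_smult_vec ne)
      thus "norm (indicator {0..1} t *\<^sub>R G (e t *s u)) \<le> norm (indicator {0..1} t * (C * exp (- (a - c) * (norm u)\<^sup>2)))"
        using C by (simp add: indicator_def)
    qed
  qed
  hence "(\<integral>t. (\<integral>u. indicator {0..1} t *\<^sub>R G (e t *s u) \<partial>lborel) \<partial>lborel)
      = (\<integral>u. (\<integral>t. indicator {0..1} t *\<^sub>R G (e t *s u) \<partial>lborel) \<partial>lborel)"
    by (rule lborel_pair.Fubini_integral[symmetric])
  moreover have "(\<integral>t. (\<integral>u. indicator {0..1} t *\<^sub>R G (e t *s u) \<partial>lborel) \<partial>lborel) = (\<integral>u. G u \<partial>lborel)"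
    by (simp add: rot)
  moreover have "(\<integral>t. indicator {0..1} t *\<^sub>R G (e t *s u) \<partial>lborel)
      = F 0 * of_real (exp (- a * (norm u)\<^sup>2))" for u
  proof -
    let ?f = "\<lambda>t. F (e t *s u)"
    have c: "continuous_on {0..1} ?f"
    proof (rule continuous_on_compose2[OF cont])
      show "continuous_on {0..1} (\<lambda>t. e t *s u)"
        using continuous_on_compose2[OF contm, of "{0..1}" "\<lambda>t. (t, u)"] by (simp add: continuous_on_Pair)
    qed simp
    have "integral {0..1} ?f = F 0"
      using entire_circle_average[OF hol[of u]] by (simp add: e_def integral_unique)
    hence "(LINT t:{0..1}|lborel. ?f t) = F 0"
      using borel_integrable_atLeastAtMost'[OF c] by (simp add: set_borel_integral_eq_integral)
    hence "(\<integral>t. (indicator {0..1} t *\<^sub>R ?f t) * of_real (exp (- a * (norm u)\<^sup>2)) \<partial>lborel)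
        = F 0 * of_real (exp (- a * (norm u)\<^sup>2))"
      by (simp add: set_lebesgue_integral_def del: mult_scaleR_left)
    thus ?thesis
      by (simp add: G_def norm_smult_vec ne)
  qed
  ultimately have "(\<integral>u. G u \<partial>lborel) = (\<integral>u. F 0 * of_real (exp (- a * (norm u)\<^sup>2)) \<partial>(lborel :: (complex^'n) measure))"
    by simp
  thus ?thesis by (simp add: G_def integral_complex_of_real)
qed

subsection \<open>The bilinear pairing and entire functions\<close>

text \<open>Lets squared norms be expanded by the rules for the bilinear pairing, keeping the
  antiholomorphic part visible as \<open>vcnj\<close>.\<close>

lemma norm_vec_sq: "complex_of_real ((norm z)\<^sup>2) = bilin (vcnj z) z"
proof -
  have "complex_of_real ((norm z)\<^sup>2) = (\<Sum>j\<in>UNIV. complex_of_real ((cmod (z $ j))\<^sup>2))"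
    by (simp add: norm_vec_def L2_set_def sum_nonneg)
  thus ?thesis unfolding bilin_def vcnj_def by (simp add: complex_norm_square mult.commute del: of_real_power)
qed

lemma norm_bilin_le: "norm (bilin z w) \<le> norm z * norm w"
proof -
  have "norm (bilin z w) \<le> (\<Sum>j\<in>UNIV. \<bar>cmod (z $ j)\<bar> * \<bar>cmod (w $ j)\<bar>)"
    unfolding bilin_def by (rule order_trans[OF norm_sum]) (simp add: norm_mult)
  also have "\<dots> \<le> norm z * norm w" unfolding norm_vec_def by (rule L2_set_mult_ineq)
  finally show ?thesis .
qed

lemma bilin_commute: "bilin z w = bilin w z"
  by (simp add: bilin_def mult.commute)

lemma bilin_add_left: "bilin (z + z') w = bilin z w + bilin z' w"
  by (simp add: bilin_def distrib_right sum.distrib)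

lemma bilin_add_right: "bilin z (w + w') = bilin z w + bilin z w'"
  by (simp add: bilin_def distrib_left sum.distrib)

lemma bilin_diff_right: "bilin z (w - w') = bilin z w - bilin z w'"
  by (simp add: bilin_def right_diff_distrib sum_subtractf)

lemma bilin_matrix: "bilin z (M *v w) = bilin (transpose M *v z) w"
proof -
  have "bilin z (M *v w) = (\<Sum>i\<in>UNIV. \<Sum>j\<in>UNIV. z $ i * (M $ i $ j * w $ j))"
    by (simp add: bilin_def matrix_vector_mult_def sum_distrib_left)
  also have "\<dots> = (\<Sum>j\<in>UNIV. \<Sum>i\<in>UNIV. z $ i * (M $ i $ j * w $ j))" by (rule sum.swap)
  also have "\<dots> = bilin (transpose M *v z) w"
    by (simp add: bilin_def matrix_vector_mult_def transpose_def sum_distrib_left sum_distrib_right mult_ac)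
  finally show ?thesis .
qed

lemma cnj_bilin: "cnj (bilin z w) = bilin (vcnj z) (vcnj w)"
  by (simp add: bilin_def vcnj_def)

lemma vcnj_simps [simp]: "vcnj (vcnj z) = z" "vcnj 0 = 0" "norm (vcnj z) = norm z"
  "vcnj (z + w) = vcnj z + vcnj w"
  by (simp_all add: vcnj_def vec_eq_iff norm_vec_def)

lemma vcnj_mult: "vcnj (M *v z) = mcnj M *v vcnj z"
  by (simp add: vcnj_def vec_eq_iff matrix_vector_mult_def map_matrix_def)

lemma bilin_zero [simp]: "bilin 0 w = 0" "bilin z 0 = 0"
  by (simp_all add: bilin_def)

section \<open>Closure properties of entire functions\<close>

lemma entire_const: "entire (\<lambda>_. c)"
  unfolding entire_def by (intro allI exI[of _ "\<lambda>_. 0"]) auto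

lemma entire_add: assumes "entire f" "entire g" shows "entire (\<lambda>z. f z + g z)"
  unfolding entire_def
proof
  fix z
  obtain D E where "(f has_derivative D) (at z)" "\<forall>c v. D (c *s v) = c * D v"
    "(g has_derivative E) (at z)" "\<forall>c v. E (c *s v) = c * E v"
    using assms unfolding entire_def by metis
  thus "\<exists>D. ((\<lambda>z. f z + g z) has_derivative D) (at z) \<and> (\<forall>c v. D (c *s v) = c * D v)"
    by (intro exI[of _ "\<lambda>v. D v + E v"]) (auto intro!: has_derivative_add simp: algebra_simps)
qed

lemma entire_mult: assumes "entire f" "entire g" shows "entire (\<lambda>z. f z * g z)"
  unfolding entire_def
proof
  fix z
  obtain D E where "(f has_derivative D) (at z)" "\<forall>c v. D (c *s v) = c * D v"
    "(g has_derivative E) (at z)" "\<forall>c v. E (c *s v) = c * E v"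
    using assms unfolding entire_def by metis
  thus "\<exists>D. ((\<lambda>z. f z * g z) has_derivative D) (at z) \<and> (\<forall>c v. D (c *s v) = c * D v)"
    by (intro exI[of _ "\<lambda>v. f z * E v + D v * g z"]) (auto intro!: derivative_eq_intros simp: algebra_simps)
qed

lemma entire_exp: assumes "entire f" shows "entire (\<lambda>z. exp (f z))"
  unfolding entire_def
proof
  fix z
  obtain D where D: "(f has_derivative D) (at z)" "\<forall>c v. D (c *s v) = c * D v"
    using assms unfolding entire_def by metis
  have "((\<lambda>z. exp (f z)) has_derivative (\<lambda>v. exp (f z) * D v)) (at z)"
    using has_derivative_compose[OF D(1), of exp "(*) (exp (f z))"] DERIV_exp[of "f z"]
    by (simp add: has_field_derivative_def)
  thus "\<exists>D. ((\<lambda>z. exp (f z)) has_derivative D) (at z) \<and> (\<forall>c v. D (c *s v) = c * D v)"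
    using D(2) by (intro exI[of _ "\<lambda>v. exp (f z) * D v"]) auto
qed

lemma entire_linear:
  assumes "bounded_linear D" "\<And>c v. D (c *s v) = c * D v" shows "entire D"
  unfolding entire_def using assms bounded_linear_imp_has_derivative by blast

lemma entire_sum: assumes "\<And>i. i \<in> I \<Longrightarrow> entire (f i)" shows "entire (\<lambda>z. \<Sum>i\<in>I. f i z)"
  using assms by (induction I rule: infinite_finite_induct) (auto intro: entire_const entire_add)

lemma entire_nth: "entire (\<lambda>z :: complex^'n. z $ i)"
  by (rule entire_linear) (auto intro: bounded_linear_vec_nth)

lemma entire_matrix_nth: "entire (\<lambda>z :: complex^'n. (M *v z) $ i)"
  unfolding matrix_vector_mult_def by (auto intro!: entire_sum entire_mult entire_nth entire_const)

lemma entire_bilin: "entire (\<lambda>z :: complex^'n. bilin a z)"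
  unfolding bilin_def by (auto intro!: entire_sum entire_mult entire_nth entire_const)

lemma entire_quadratic: "entire (\<lambda>z :: complex^'n. bilin z (M *v z))"
  unfolding bilin_def by (intro entire_sum entire_mult entire_nth entire_matrix_nth)

lemma entire_continuous: "entire f \<Longrightarrow> continuous_on UNIV f"
  unfolding entire_def
  by (metis continuous_at_imp_continuous_on has_derivative_continuous)

lemma bounded_linear_smult_left: "bounded_linear (\<lambda>c. c *s (u :: complex^'n))"
  by (rule bounded_linear_intro[of _ "norm u"])
    (simp_all add: vec_eq_iff norm_smult_vec distrib_right mult.commute)

text \<open>The passage to one complex variable: along a line the chain rule gives
  \<open>h |-> D (h *s u)\<close>, and complex linearity of \<open>D\<close> turns this into
  multiplication by the number \<open>D u\<close>.\<close>

lemma entire_holomorphic_line: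
  assumes "entire f" shows "(\<lambda>c. f (c *s u)) holomorphic_on UNIV"
proof -
  have "\<exists>f'. ((\<lambda>c. f (c *s u)) has_field_derivative f') (at c)" for c
  proof -
    obtain D where D: "(f has_derivative D) (at (c *s u))" "\<forall>c v. D (c *s v) = c * D v"
      using assms unfolding entire_def by metis
    have "((\<lambda>c. f (c *s u)) has_derivative (\<lambda>h. D (h *s u))) (at c)"
      by (rule has_derivative_compose[OF bounded_linear_imp_has_derivative[OF bounded_linear_smult_left] D(1)])
    moreover have "(\<lambda>h. D (h *s u)) = (*) (D u)" using D(2) by (simp add: fun_eq_iff)
    ultimately show ?thesis by (auto simp: has_field_derivative_def)
  qed
  thus ?thesis by (simp add: holomorphic_on_def field_differentiable_def)
qed

subsection \<open>The reproducing property\<close>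

text \<open>The strict inequality \<open>c < a\<close> leaves room to absorb lower-order terms and
  makes \<open>f\<close> integrable against \<open>exp (- a * (norm z)\<^sup>2)\<close>. Having
  \<open>0 \<le> c\<close> makes the bound increase with \<open>norm z\<close>, which the estimate
  of translates uses.\<close>

definition gauss_bounded :: "real \<Rightarrow> (complex^'n \<Rightarrow> complex) \<Rightarrow> bool" where
  "gauss_bounded a f \<longleftrightarrow> (\<exists>C c. 0 \<le> c \<and> c < a \<and> (\<forall>z. norm (f z) \<le> C * exp (c * (norm z)\<^sup>2)))"

lemma entire_shift: assumes "entire f" shows "entire (\<lambda>z. f (w + z))"
  unfolding entire_def
proof
  fix z
  obtain D where D: "(f has_derivative D) (at (w + z))" "\<forall>c v. D (c *s v) = c * D v"
    using assms unfolding entire_def by metis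
  have "((\<lambda>z. f (w + z)) has_derivative D) (at z)"
    by (rule has_derivative_compose[of "\<lambda>z. w + z" "\<lambda>v. v", OF _ D(1)]) (auto intro!: derivative_eq_intros)
  thus "\<exists>D. ((\<lambda>z. f (w + z)) has_derivative D) (at z) \<and> (\<forall>c v. D (c *s v) = c * D v)"
    using D(2) by blast
qed

lemma gauss_boundedE:
  assumes "gauss_bounded a f"
  obtains C c where "0 \<le> C" "0 \<le> c" "c < a" "\<And>z. norm (f z) \<le> C * exp (c * (norm z)\<^sup>2)"
proof -
  obtain C c where *: "0 \<le> c" "c < a" "\<And>z. norm (f z) \<le> C * exp (c * (norm z)\<^sup>2)"
    using assms unfolding gauss_bounded_def by blast
  have "0 \<le> C" using order_trans[OF norm_ge_zero *(3)[of 0]] by simp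
  thus ?thesis using * by (intro that)
qed

lemma gauss_bounded_mono: "gauss_bounded a f \<Longrightarrow> a \<le> b \<Longrightarrow> gauss_bounded b f"
  unfolding gauss_bounded_def by (meson less_le_trans)

lemma gauss_bounded_mult:
  assumes "gauss_bounded a f" "gauss_bounded b g"
  shows "gauss_bounded (a + b) (\<lambda>z. f z * g z)"
proof -
  obtain C c where f: "0 \<le> C" "0 \<le> c" "c < a" "\<And>z. norm (f z) \<le> C * exp (c * (norm z)\<^sup>2)"
    using assms(1) by (rule gauss_boundedE) blast
  obtain D d where g: "0 \<le> D" "0 \<le> d" "d < b" "\<And>z. norm (g z) \<le> D * exp (d * (norm z)\<^sup>2)"
    using assms(2) by (rule gauss_boundedE) blast
  have "norm (f z * g z) \<le> (C * D) * exp ((c + d) * (norm z)\<^sup>2)" for z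
  proof -
    have "norm (f z * g z) \<le> (C * exp (c * (norm z)\<^sup>2)) * (D * exp (d * (norm z)\<^sup>2))"
      unfolding norm_mult using f g by (intro mult_mono) auto
    thus ?thesis by (simp add: exp_add distrib_right mult_ac)
  qed
  thus ?thesis
    unfolding gauss_bounded_def using f g
    by (intro exI[of _ "C * D"] exI[of _ "c + d"]) auto
qed

text \<open>Half of the gap pays for the linear exponent: completing the square gives
  \<open>L * r \<le> e * r\<^sup>2 + L\<^sup>2 / (4 * e)\<close>.\<close>

lemma gauss_boundedI:
  assumes "0 \<le> C" "0 \<le> c" "c < a" "\<And>z. norm (f z) \<le> C * exp (c * (norm z)\<^sup>2 + L * norm z + K)"
  shows "gauss_bounded a f"
proof -
  define e where "e = (a - c) / 2"
  have e: "e > 0" "c + e < a" using assms(3) by (simp_all add: e_def field_simps)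
  have "norm (f z) \<le> (C * exp (L\<^sup>2 / (4 * e) + K)) * exp ((c + e) * (norm z)\<^sup>2)" for z
  proof -
    have "0 \<le> (2 * e * norm z - L)\<^sup>2 / (4 * e)" using e by simp
    also have "\<dots> = e * (norm z)\<^sup>2 - L * norm z + L\<^sup>2 / (4 * e)"
      using e by (simp add: power2_diff field_simps power2_eq_square)
    finally have "c * (norm z)\<^sup>2 + L * norm z + K \<le> L\<^sup>2 / (4 * e) + K + (c + e) * (norm z)\<^sup>2"
      by (simp add: algebra_simps)
    hence "C * exp (c * (norm z)\<^sup>2 + L * norm z + K) \<le> C * exp (L\<^sup>2 / (4 * e) + K + (c + e) * (norm z)\<^sup>2)"
      using assms(1) by (intro mult_left_mono) auto
    thus ?thesis using assms(4)[of z] by (simp add: exp_add mult_ac)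
  qed
  thus ?thesis unfolding gauss_bounded_def using e assms(2)
    by (intro exI[of _ "C * exp (L\<^sup>2 / (4 * e) + K)"] exI[of _ "c + e"]) auto
qed

lemma gauss_bounded_exp:
  assumes "0 \<le> c" "c < a" "\<And>z. Re (f z) \<le> c * (norm z)\<^sup>2 + L * norm z + K"
  shows "gauss_bounded a (\<lambda>z. exp (f z))"
  using assms by (intro gauss_boundedI[of 1 c _ _ L K]) auto

text \<open>With \<open>E = exp (c * r\<^sup>2)\<close>, the inequality
  \<open>1 + x \<le> exp x\<close> bounds 1 by \<open>E\<close> and \<open>r\<^sup>2\<close> by
  \<open>E / c\<close>, and \<open>r \<le> 1 + r\<^sup>2\<close> bounds \<open>r\<close> by their
  sum; \<open>C\<close> collects the coefficients.\<close>

lemma gauss_bounded_poly: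
  assumes "a > 0" "\<And>z. norm (f z) \<le> K + L * norm z + M * (norm z)\<^sup>2"
  shows "gauss_bounded a f"
proof -
  define c where "c = a / 2"
  have c: "c > 0" "c < a" using assms by (auto simp: c_def)
  define C where "C = \<bar>K\<bar> + \<bar>L\<bar> + (\<bar>L\<bar> + \<bar>M\<bar>) / c"
  have "norm (f z) \<le> C * exp (c * (norm z)\<^sup>2)" for z
  proof -
    let ?r = "norm z" and ?e = "exp (c * (norm z)\<^sup>2)"
    have e: "1 + c * ?r\<^sup>2 \<le> ?e" by (rule exp_ge_add_one_self)
    have "0 \<le> c * ?r\<^sup>2" using c by simp
    hence e1: "1 \<le> ?e" and "c * ?r\<^sup>2 \<le> ?e" using e by linarith+
    hence e2: "?r\<^sup>2 \<le> ?e / c" using c by (simp add: field_simps)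
    have "?r \<le> 1 + ?r\<^sup>2"
    proof -
      have "0 \<le> (?r - 1)\<^sup>2" by simp
      moreover have "(?r - 1)\<^sup>2 = ?r\<^sup>2 - 2 * ?r + 1" by (simp add: power2_diff)
      moreover have "0 \<le> ?r" by simp
      ultimately show ?thesis by linarith
    qed
    hence e3: "?r \<le> ?e + ?e / c" using e1 e2 by linarith
    have "norm (f z) \<le> \<bar>K\<bar> + \<bar>L\<bar> * ?r + \<bar>M\<bar> * ?r\<^sup>2"
      by (rule order_trans[OF assms(2)]) (intro add_mono mult_right_mono; simp)
    also have "\<dots> \<le> \<bar>K\<bar> * ?e + \<bar>L\<bar> * (?e + ?e / c) + \<bar>M\<bar> * (?e / c)"
      using e1 e2 e3 by (intro add_mono mult_left_mono) (auto intro: mult_left_mono[of 1 ?e "\<bar>K\<bar>", simplified])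
    also have "\<dots> = C * ?e" by (simp add: C_def algebra_simps add_divide_distrib)
    finally show ?thesis .
  qed
  thus ?thesis unfolding gauss_bounded_def using c by (intro exI[of _ C] exI[of _ c]) auto
qed

section \<open>Integrals against \<open>mu\<close> and membership in the Fock space\<close>

lemma mu_eq_density:
  "lam > 0 \<Longrightarrow> (mu lam :: (complex^'n) measure) = density lborel (\<lambda>_. ennreal ((lam / (2 * pi)) ^ CARD('n)))"
  by (simp add: mu_def power_divide)

lemma integrable_mu:
  fixes f :: "complex^'n \<Rightarrow> 'b::{banach, second_countable_topology}"
  assumes "lam > 0" "integrable lborel f"
  shows "integrable (mu lam) f"
  unfolding mu_eq_density[OF assms(1)] using assms by (subst integrable_density) auto

lemma integral_mu:
  fixes f :: "complex^'n \<Rightarrow> complex"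
  assumes "lam > 0" "f \<in> borel_measurable borel"
  shows "(\<integral>z. f z \<partial>mu lam) = of_real (lam / (2 * pi)) ^ CARD('n) * (\<integral>z. f z \<partial>lborel)"
  unfolding mu_eq_density[OF assms(1)] using assms
  by (subst integral_density) (auto simp: scaleR_conv_of_real)

lemma integrable_gauss_bounded:
  fixes f :: "complex^'n \<Rightarrow> complex"
  assumes "continuous_on UNIV f" "gauss_bounded a f"
  shows "integrable lborel (\<lambda>z. f z * of_real (exp (- a * (norm z)\<^sup>2)))"
proof -
  obtain C c where f: "0 \<le> C" "0 \<le> c" "c < a" "\<And>z. norm (f z) \<le> C * exp (c * (norm z)\<^sup>2)"
    using assms(2) by (rule gauss_boundedE) blast
  show ?thesis
  proof (rule integrable_gaussian_bound)
    show "(\<lambda>z. f z * of_real (exp (- a * (norm z)\<^sup>2))) \<in> borel_measurable borel"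
      by (intro borel_measurable_continuous_onI continuous_intros assms)
    show "norm (f z * of_real (exp (- a * (norm z)\<^sup>2))) \<le> C * exp (- (a - c) * (norm z)\<^sup>2)" for z
    proof -
      have "norm (f z * of_real (exp (- a * (norm z)\<^sup>2))) \<le> C * exp (c * (norm z)\<^sup>2) * exp (- a * (norm z)\<^sup>2)"
        unfolding norm_mult using f by (simp add: mult_right_mono)
      thus ?thesis by (simp add: algebra_simps flip: exp_add)
    qed
  qed (use f in auto)
qed

text \<open>Squaring doubles the rate \<open>lam / 4\<close> to \<open>lam / 2\<close>, the rate of
  the weight in the norm.\<close>

lemma fockI:
  assumes "lam > 0" "entire f" "gauss_bounded (lam / 4) f"
  shows "f \<in> fock lam"
proof -
  have c: "continuous_on UNIV f" using assms(2) by (rule entire_continuous)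
  have "gauss_bounded (lam / 2) (\<lambda>z. f z * f z)"
    using gauss_bounded_mult[OF assms(3,3)] by simp
  hence "integrable lborel (\<lambda>z. f z * f z * of_real (exp (- (lam / 2) * (norm z)\<^sup>2)))"
    by (intro integrable_gauss_bounded continuous_intros c)
  hence "integrable lborel (\<lambda>z. (norm (f z))\<^sup>2 * exp (- lam * (norm z)\<^sup>2 / 2))"
    by (drule_tac integrable_norm) (simp add: norm_mult power2_eq_square)
  thus ?thesis
    using assms by (simp add: fock_def integrable_mu)
qed

text \<open>The real dimension is \<open>2 * CARD('n)\<close>, so the square roots pair up to
  \<open>(2 * pi / lam) ^ CARD('n)\<close> and cancel the normalisation of
  \<open>mu\<close>.\<close>

lemma integral_gaussian_mu:
  assumes "lam > 0"
  shows "of_real (lam / (2 * pi)) ^ CARD('n) *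
    complex_of_real (\<integral>u. exp (- (lam / 2) * (norm u)\<^sup>2) \<partial>(lborel :: (complex^'n) measure)) = 1"
proof -
  have "(\<integral>u. exp (- (lam / 2) * (norm u)\<^sup>2) \<partial>(lborel :: (complex^'n) measure))
      = sqrt (pi / (lam / 2)) ^ DIM(complex^'n)"
    using assms by (intro has_bochner_integral_integral_eq has_bochner_integral_gaussian) simp
  also have "\<dots> = (2 * pi / lam) ^ CARD('n)"
    using assms by (simp add: power_mult mult.commute[of _ 2])
  finally have "(lam / (2 * pi)) ^ CARD('n) * (\<integral>u. exp (- (lam / 2) * (norm u)\<^sup>2) \<partial>(lborel :: (complex^'n) measure))
      = (lam / (2 * pi) * (2 * pi / lam)) ^ CARD('n)"
    by (simp only: power_mult_distrib)
  also have "\<dots> = 1" using assms by simp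
  finally show ?thesis by (simp only: of_real_mult[symmetric] of_real_power[symmetric] of_real_1)
qed

lemma coherent_alt: "coherent lam w u = exp (of_real lam / 2 * bilin (vcnj w) u)"
  by (simp add: coherent_def)

text \<open>Phrased with a growth bound instead of membership in \<open>fock lam\<close>: the bound
  survives translation by \<open>w\<close> and directly provides the majorant for the mean value
  argument.\<close>

lemma coherent_pairing:
  fixes g :: "complex^'n \<Rightarrow> complex"
  assumes lam: "lam > 0" and g: "entire g" "gauss_bounded (lam / 2) g"
  shows "integrable (mu lam) (\<lambda>u. g u * cnj (coherent lam w u) * of_real (exp (- lam * (norm u)\<^sup>2 / 2)))"
    and "(\<integral>u. g u * cnj (coherent lam w u) * of_real (exp (- lam * (norm u)\<^sup>2 / 2)) \<partial>mu lam) = g w"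
proof -
  let ?h = "\<lambda>u. g u * cnj (coherent lam w u) * of_real (exp (- lam * (norm u)\<^sup>2 / 2))"
  \<comment> \<open>In the translated integrand the conjugated coherent state cancels the terms
    \<open>bilin w (vcnj w)\<close> and \<open>bilin w (vcnj u)\<close> of the expanded
    \<open>(norm (w + u))\<^sup>2\<close>. The remaining cross term is holomorphic in
    \<open>u\<close> and goes into \<open>F\<close>, which satisfies
    \<open>F 0 = g w\<close>.\<close>
  define F where "F u = g (w + u) * exp (- (of_real lam / 2) * bilin (vcnj w) u)" for u
  have cg: "continuous_on UNIV g" using g by (simp add: entire_continuous)
  have cb: "continuous_on UNIV (\<lambda>u. bilin (vcnj w) u)" by (simp add: entire_bilin entire_continuous)
  have cF: "continuous_on UNIV F"
    unfolding F_def by (intro continuous_intros cb continuous_on_compose2[OF cg]) auto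
  have ch: "continuous_on UNIV ?h"
    unfolding coherent_alt by (intro continuous_intros cb cg) auto
  have hm [measurable]: "?h \<in> borel_measurable borel"
    using ch by (rule borel_measurable_continuous_onI)
  have shift: "?h (w + u) = F u * of_real (exp (- (lam / 2) * (norm u)\<^sup>2))" for u
  proof -
    have "complex_of_real ((norm (w + u))\<^sup>2) = bilin w (vcnj w) + bilin w (vcnj u) + bilin (vcnj w) u
        + complex_of_real ((norm u)\<^sup>2)"
      unfolding norm_vec_sq
      by (simp add: bilin_add_left bilin_add_right bilin_commute[of "vcnj u"] bilin_commute[of "vcnj w" w])
    hence "of_real (exp (- lam * (norm (w + u))\<^sup>2 / 2)) =
      exp (- (of_real lam / 2) * (bilin w (vcnj w) + bilin w (vcnj u) + bilin (vcnj w) u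
        + complex_of_real ((norm u)\<^sup>2)))"
      by (simp add: exp_of_real[symmetric])
    thus ?thesis
      by (simp add: F_def coherent_alt exp_cnj cnj_bilin bilin_add_right algebra_simps exp_of_real[symmetric] flip: exp_add)
  qed
  obtain C c where gb: "0 \<le> C" "0 \<le> c" "c < lam / 2" "\<And>z. norm (g z) \<le> C * exp (c * (norm z)\<^sup>2)"
    using g(2) by (rule gauss_boundedE) blast
  \<comment> \<open>Translation and the extra factor change the exponent of the bound by terms at
    most linear in \<open>norm u\<close>, which the gap absorbs.\<close>
  have Fb: "gauss_bounded (lam / 2) F"
  proof (rule gauss_boundedI[OF gb(1-3)])
    fix u
    have "norm (w + u) \<le> norm w + norm u" by (rule norm_triangle_ineq)
    hence "(norm (w + u))\<^sup>2 \<le> (norm w + norm u)\<^sup>2" by (intro power_mono) auto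
    hence "c * (norm (w + u))\<^sup>2 \<le> c * (norm w + norm u)\<^sup>2" using gb(2) by (intro mult_left_mono)
    hence "C * exp (c * (norm (w + u))\<^sup>2) \<le> C * exp (c * (norm w + norm u)\<^sup>2)"
      using gb(1) by (intro mult_left_mono) auto
    hence 1: "norm (g (w + u)) \<le> C * exp (c * (norm w + norm u)\<^sup>2)" using gb(4)[of "w + u"] by linarith
    have "- Re (bilin (vcnj w) u) \<le> norm (bilin (vcnj w) u)" using abs_Re_le_cmod[of "bilin (vcnj w) u"] by linarith
    also have "\<dots> \<le> norm w * norm u" using norm_bilin_le[of "vcnj w" u] by simp
    finally have "lam / 2 * - Re (bilin (vcnj w) u) \<le> lam / 2 * (norm w * norm u)"
      using lam by (intro mult_left_mono) auto
    hence 2: "norm (exp (- (of_real lam / 2) * bilin (vcnj w) u)) \<le> exp (lam / 2 * (norm w * norm u))"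
      by simp
    have "norm (F u) \<le> (C * exp (c * (norm w + norm u)\<^sup>2)) * exp (lam / 2 * (norm w * norm u))"
      unfolding F_def norm_mult using 1 2 gb(1) by (intro mult_mono) auto
    also have "\<dots> = C * exp (c * (norm w + norm u)\<^sup>2 + lam / 2 * (norm w * norm u))"
      by (simp add: exp_add)
    also have "c * (norm w + norm u)\<^sup>2 + lam / 2 * (norm w * norm u)
        = c * (norm u)\<^sup>2 + (2 * c * norm w + lam / 2 * norm w) * norm u + c * (norm w)\<^sup>2"
      by (simp add: power2_sum algebra_simps)
    finally show "norm (F u) \<le> C * exp (c * (norm u)\<^sup>2 + (2 * c * norm w + lam / 2 * norm w) * norm u + c * (norm w)\<^sup>2)" .
  qed
  have Fi: "integrable lborel (\<lambda>u. F u * of_real (exp (- (lam / 2) * (norm u)\<^sup>2)))"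
    using cF Fb by (rule integrable_gauss_bounded)
  have hd: "integrable lborel ?h = integrable (distr lborel borel ((+) w)) ?h"
    "(\<integral>u. ?h u \<partial>lborel) = (\<integral>u. ?h u \<partial>distr lborel borel ((+) w))"
    by (simp_all only: lborel_distr_plus)
  have "integrable lborel ?h"
    unfolding hd
  proof (subst integrable_distr_eq[OF _ hm])
    show "integrable lborel (\<lambda>u. ?h (w + u))" unfolding shift by (rule Fi)
  qed simp
  thus "integrable (mu lam) ?h" by (rule integrable_mu[OF lam])
  obtain D d where Fb': "0 \<le> d" "d < lam / 2" "\<And>z. norm (F z) \<le> D * exp (d * (norm z)\<^sup>2)"
    using Fb by (rule gauss_boundedE) blast
  have "entire F"
    unfolding F_def by (rule entire_mult[OF entire_shift[OF g(1)] entire_exp[OF entire_mult[OF entire_const entire_bilin]]])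
  note Fline = entire_holomorphic_line[OF this]
  have "(\<integral>u. ?h u \<partial>lborel) = (\<integral>u. ?h (w + u) \<partial>lborel)"
    unfolding hd by (subst integral_distr[OF _ hm]) simp_all
  also have "\<dots> = F 0 * of_real (\<integral>u. exp (- (lam / 2) * (norm u)\<^sup>2) \<partial>(lborel :: (complex^'n) measure))"
    unfolding shift using Fb'(2,3) by (intro gaussian_mean_value[OF Fline cF]) auto
  finally have eq: "(\<integral>u. ?h u \<partial>lborel) = g w * of_real (\<integral>u. exp (- (lam / 2) * (norm u)\<^sup>2) \<partial>(lborel :: (complex^'n) measure))"
    by (simp add: F_def)
  show "(\<integral>u. ?h u \<partial>mu lam) = g w"
    unfolding integral_mu[OF lam hm] eq mult.left_commute[of _ "g w"] integral_gaussian_mu[OF lam] by simp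
qed

subsection \<open>The group $S$\<close>

lemma mcnj_mult: "mcnj (A ** B) = mcnj A ** mcnj B"
  by (simp add: vec_eq_iff matrix_matrix_mult_def map_matrix_def)

lemma mcnj_mcnj [simp]: "mcnj (mcnj A) = A"
  by (simp add: vec_eq_iff map_matrix_def)

lemma mcnj_add: "mcnj (A + B) = mcnj A + mcnj B"
  by (simp add: vec_eq_iff map_matrix_def)

lemma mcnj_diff: "mcnj (A - B) = mcnj A - mcnj B"
  by (simp add: vec_eq_iff map_matrix_def)

lemma mcnj_uminus: "mcnj (- A) = - mcnj A"
  by (simp add: vec_eq_iff map_matrix_def)

lemma mcnj_mat [simp]: "mcnj (mat 1) = mat 1" "mcnj 0 = 0"
  by (simp_all add: vec_eq_iff map_matrix_def mat_def)

lemma adj_mult: "adj (A ** B) = adj B ** adj A"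
  by (simp add: adj_def matrix_transpose_mul mcnj_mult)

lemma transpose_mcnj: "transpose (mcnj A) = adj A"
  by (simp add: adj_def vec_eq_iff map_matrix_def transpose_def)

lemma mcnj_transpose: "mcnj (transpose A) = adj A"
  by (simp add: adj_def)

lemma adj_mcnj: "adj (mcnj A) = transpose A"
  by (simp add: adj_def vec_eq_iff map_matrix_def transpose_def)

lemma adj_transpose: "adj (transpose A) = mcnj A"
  by (simp add: adj_def)

lemma transpose_adj: "transpose (adj A) = mcnj A"
  by (simp add: adj_def vec_eq_iff map_matrix_def transpose_def)

lemma mcnj_adj: "mcnj (adj A) = transpose A"
  by (simp add: adj_def)

lemma adj_adj: "adj (adj A) = A"
  by (simp add: adj_def vec_eq_iff map_matrix_def transpose_def)

lemmas cnj_transpose_simps = mcnj_mult adj_mult matrix_transpose_mul transpose_mcnj mcnj_transpose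
  adj_mcnj adj_transpose transpose_adj mcnj_adj adj_adj

lemma matrix_mul_minus_left: "(- A) ** B = - (A ** B :: 'a::ring_1^'n^'m)"
  by (simp add: vec_eq_iff matrix_matrix_mult_def sum_negf)

lemma matrix_mul_minus_right: "A ** (- B) = - (A ** B :: 'a::ring_1^'n^'m)"
  by (simp add: vec_eq_iff matrix_matrix_mult_def sum_negf)

lemma matrix_mul_diff_left: "(A - B) ** C = A ** C - (B ** C :: 'a::ring_1^'n^'m)"
  by (simp add: vec_eq_iff matrix_matrix_mult_def sum_subtractf left_diff_distrib)

lemma matrix_mul_diff_right: "A ** (B - C) = A ** B - (A ** C :: 'a::ring_1^'n^'m)"
  by (simp add: vec_eq_iff matrix_matrix_mult_def sum_subtractf right_diff_distrib)

lemma norm_matrix_vector_sq: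
  "complex_of_real ((norm (M *v v))\<^sup>2) = bilin (vcnj v) ((adj M ** M) *v v)"
proof -
  have "complex_of_real ((norm (M *v v))\<^sup>2) = bilin (transpose (adj M) *v vcnj v) (M *v v)"
    by (simp add: norm_vec_sq vcnj_mult transpose_adj del: of_real_power)
  also have "\<dots> = bilin (vcnj v) (adj M *v (M *v v))" by (rule bilin_matrix[symmetric])
  finally show ?thesis by (simp add: matrix_vector_mul_assoc)
qed

text \<open>The hypothesis says that \<open>v |-> (N *v v, R *v v)\<close> is an isometry.\<close>

lemma norm_sq_of_adj_sum:
  assumes "adj N ** N + adj R ** R = mat 1"
  shows "(norm (N *v v))\<^sup>2 + (norm (R *v v))\<^sup>2 = (norm v)\<^sup>2"
proof -
  have "complex_of_real ((norm (N *v v))\<^sup>2 + (norm (R *v v))\<^sup>2)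
      = bilin (vcnj v) ((adj N ** N + adj R ** R) *v v)"
    unfolding of_real_add norm_matrix_vector_sq
    by (simp add: matrix_vector_mult_add_rdistrib bilin_add_right)
  also have "\<dots> = complex_of_real ((norm v)\<^sup>2)" by (simp add: assms norm_vec_sq del: of_real_power)
  finally show ?thesis by (simp only: of_real_eq_iff)
qed

lemma linear_matrix_vector: "linear (\<lambda>v. (M :: complex^'n^'m) *v v)"
  by (rule linearI) (simp_all add: vec_eq_iff matrix_vector_mult_def distrib_left sum.distrib scaleR_sum_right)

lemma norm_matrix_vector_bound:
  fixes M :: "complex^'n^'m" obtains K where "K > 0" "\<And>v. norm (M *v v) \<le> K * norm v"
proof -
  have "bounded_linear (\<lambda>v. M *v v)" using linear_matrix_vector by (simp add: linear_conv_bounded_linear)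
  thus ?thesis using bounded_linear.pos_bounded that by (metis mult.commute)
qed

text \<open>From \<open>v = P *v (R *v v)\<close> the norm of \<open>R *v v\<close> is at least
  \<open>norm v / K\<close>, so the isometry leaves at most the fraction
  \<open>1 - 1 / K\<^sup>2\<close> of the squared norm to \<open>N *v v\<close>.\<close>

lemma strict_contraction:
  fixes N R P :: "complex^'n^'n"
  assumes "adj N ** N + adj R ** R = mat 1" "P ** R = mat 1"
  obtains m where "0 \<le> m" "m < 1" "\<And>v. norm (N *v v) \<le> m * norm v"
proof -
  obtain K where K: "K > 0" "\<And>v. norm (P *v v) \<le> K * norm v"
    using norm_matrix_vector_bound[of P] by blast
  \<comment> \<open>The \<open>max\<close> makes the root nonnegative without first establishing
    \<open>1 \<le> K\<close>.\<close>
  define m where "m = sqrt (max 0 (1 - 1 / K\<^sup>2))"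
  have "norm (N *v v) \<le> m * norm v" for v
  proof -
    have "norm v = norm (P *v (R *v v))" by (simp add: matrix_vector_mul_assoc assms(2))
    also have "\<dots> \<le> K * norm (R *v v)" by (rule K)
    finally have "(norm v)\<^sup>2 \<le> (K * norm (R *v v))\<^sup>2" by (intro power_mono) auto
    hence "(norm v)\<^sup>2 / K\<^sup>2 \<le> (norm (R *v v))\<^sup>2" using K(1) by (simp add: field_simps power_mult_distrib)
    hence "(norm (N *v v))\<^sup>2 \<le> (1 - 1 / K\<^sup>2) * (norm v)\<^sup>2"
      using norm_sq_of_adj_sum[OF assms(1), of v] by (simp add: algebra_simps)
    also have "\<dots> \<le> max 0 (1 - 1 / K\<^sup>2) * (norm v)\<^sup>2" by (intro mult_right_mono) auto
    finally have "norm (N *v v) \<le> sqrt (max 0 (1 - 1 / K\<^sup>2) * (norm v)\<^sup>2)" by (rule real_le_rsqrt)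
    thus ?thesis by (simp add: m_def real_sqrt_mult)
  qed
  moreover have "0 \<le> m" "m < 1" using K(1) by (simp_all add: m_def)
  ultimately show ?thesis by (rule that[rotated 2])
qed

section \<open>Block matrices and the relations defining the group\<close>

lemma upper_block [simp]:
  "upper_left (block A B C D) = A" "upper_right (block A B C D) = B"
  by (simp_all add: upper_left_def upper_right_def block_def)

lemma block_eq_iff:
  "block A B C D = block A' B' C' D' \<longleftrightarrow> A = A' \<and> B = B' \<and> C = C' \<and> D = D'"
  by (auto simp: block_def vec_eq_iff split: sum.splits)

lemma sum_UNIV_Plus:
  fixes f :: "'a::finite + 'b::finite \<Rightarrow> 'c::comm_monoid_add"
  shows "(\<Sum>i\<in>UNIV. f i) = (\<Sum>i\<in>UNIV. f (Inl i)) + (\<Sum>i\<in>UNIV. f (Inr i))"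
  using sum.Plus[of UNIV UNIV f] by simp

lemma block_mult:
  "block A B C D ** block A' B' C' D' =
    block (A ** A' + B ** C') (A ** B' + B ** D') (C ** A' + D ** C') (C ** B' + D ** D')"
  by (auto simp: block_def vec_eq_iff matrix_matrix_mult_def sum_UNIV_Plus split: sum.splits)

lemma block_one: "mat 1 = block (mat 1) 0 0 (mat 1)"
  by (auto simp: block_def vec_eq_iff mat_def split: sum.splits)

lemma adj_block: "adj (block A B C D) = block (adj A) (adj C) (adj B) (adj D)"
  by (auto simp: block_def vec_eq_iff adj_def map_matrix_def transpose_def split: sum.splits)

lemma group_S_block_iff:
  "block P Q (mcnj Q) (mcnj P) \<in> group_S \<longleftrightarrow>
    P ** adj P - Q ** adj Q = mat 1 \<and> P ** transpose Q = Q ** transpose P"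
  by (auto simp: group_S_def block_eq_iff)

text \<open>The defining relations together with their conjugates exhibit a right inverse of
  \<open>k\<close>. For square matrices it is also a left inverse, and the upper left block of the
  reversed product is the claim.\<close>

lemma group_S_left:
  assumes "block P Q (mcnj Q) (mcnj P) \<in> group_S"
  shows "adj P ** P - transpose Q ** mcnj Q = mat 1"
proof -
  have 1: "P ** adj P - Q ** adj Q = mat 1" and 2: "P ** transpose Q = Q ** transpose P"
    using assms by (simp_all add: group_S_block_iff)
  have "mcnj (P ** adj P - Q ** adj Q) = mcnj (mat 1)" "mcnj (P ** transpose Q) = mcnj (Q ** transpose P)"
    using 1 2 by simp_all
  hence 3: "mcnj P ** transpose P - mcnj Q ** transpose Q = mat 1" and 4: "mcnj P ** adj Q = mcnj Q ** adj P"
    by (simp_all add: mcnj_diff cnj_transpose_simps)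
  have "block P Q (mcnj Q) (mcnj P) ** block (adj P) (- transpose Q) (- adj Q) (transpose P) = mat 1"
    using 1 2 3 4 by (simp add: block_mult block_one matrix_mul_minus_right)
  hence "block (adj P) (- transpose Q) (- adj Q) (transpose P) ** block P Q (mcnj Q) (mcnj P) = mat 1"
    by (simp add: matrix_left_right_inverse)
  thus ?thesis by (simp add: block_mult block_one matrix_mul_minus_left block_eq_iff)
qed

lemma matrix_inv_works:
  assumes "invertible P" shows "P ** matrix_inv P = mat 1" "matrix_inv P ** P = mat 1"
  using someI_ex[of "\<lambda>B. P ** B = mat 1 \<and> B ** P = mat 1"] assms
  unfolding invertible_def matrix_inv_def by auto

text \<open>\<open>adj P ** P\<close> is the identity plus a positive semidefinite matrix, so
  \<open>P\<close> cannot shrink a vector and has trivial kernel.\<close>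

lemma group_S_invertible:
  assumes "block P Q (mcnj Q) (mcnj P) \<in> group_S"
  shows "invertible P"
proof -
  have eq: "adj P ** P = mat 1 + adj (mcnj Q) ** mcnj Q"
    using group_S_left[OF assms] by (simp add: adj_mcnj algebra_simps)
  have "v = 0" if "P *v v = 0" for v
  proof -
    have "complex_of_real ((norm (P *v v))\<^sup>2) = complex_of_real ((norm v)\<^sup>2) + complex_of_real ((norm (mcnj Q *v v))\<^sup>2)"
      unfolding norm_matrix_vector_sq eq norm_vec_sq[of v]
      by (simp add: matrix_vector_mult_add_rdistrib bilin_add_right)
    hence "(norm (P *v v))\<^sup>2 = (norm v)\<^sup>2 + (norm (mcnj Q *v v))\<^sup>2"
      by (simp only: of_real_add[symmetric] of_real_eq_iff)
    thus ?thesis using that by (simp add: add_nonneg_eq_0_iff)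
  qed
  thus ?thesis by (simp add: invertible_left_inverse matrix_left_invertible_ker)
qed

text \<open>The relation for \<open>adj P ** P\<close> is multiplied by \<open>adj R\<close> on the
  left and \<open>R\<close> on the right, the relation for \<open>P ** adj P\<close> the other way
  round. The second result is then conjugated, which puts it into the form
  \<open>adj N ** N + adj R ** R\<close> with transposed matrices.\<close>

lemma group_S_adj_sums:
  assumes "block P Q (mcnj Q) (mcnj P) \<in> group_S"
  defines "R \<equiv> matrix_inv P"
  shows "adj (mcnj Q ** R) ** (mcnj Q ** R) + adj R ** R = mat 1"
    and "adj (transpose (R ** Q)) ** transpose (R ** Q) + adj (transpose R) ** transpose R = mat 1"
proof -
  have R: "P ** R = mat 1" "R ** P = mat 1"
    unfolding R_def by (rule matrix_inv_works[OF group_S_invertible[OF assms(1)]])+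
  have "adj (mcnj Q ** R) ** (mcnj Q ** R) = adj R ** (transpose Q ** mcnj Q) ** R"
    by (simp add: cnj_transpose_simps matrix_mul_assoc)
  also have "transpose Q ** mcnj Q = adj P ** P - mat 1" using group_S_left[OF assms(1)] by (simp add: algebra_simps)
  also have "adj R ** (adj P ** P - mat 1) ** R = adj (P ** R) ** (P ** R) - adj R ** R"
    by (simp add: matrix_mul_diff_left matrix_mul_diff_right adj_mult matrix_mul_assoc)
  finally show "adj (mcnj Q ** R) ** (mcnj Q ** R) + adj R ** R = mat 1" by (simp add: R adj_def)
  have "(R ** Q) ** adj (R ** Q) = R ** (Q ** adj Q) ** adj R"
    by (simp add: cnj_transpose_simps matrix_mul_assoc)
  also have "Q ** adj Q = P ** adj P - mat 1" using assms(1) by (simp add: group_S_block_iff algebra_simps)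
  also have "R ** (P ** adj P - mat 1) ** adj R = (R ** P) ** adj (R ** P) - R ** adj R"
    by (simp add: matrix_mul_diff_left matrix_mul_diff_right adj_mult matrix_mul_assoc)
  finally have "mcnj ((R ** Q) ** adj (R ** Q) + R ** adj R) = mcnj (mat 1)" by (simp add: R adj_def)
  thus "adj (transpose (R ** Q)) ** transpose (R ** Q) + adj (transpose R) ** transpose R = mat 1"
    by (simp add: mcnj_add cnj_transpose_simps matrix_mul_assoc)
qed

text \<open>The two quadratic forms govern the growth of the kernel in its first and second
  argument. The second contraction is known for the transpose of \<open>R ** Q\<close>, which has
  the same quadratic form.\<close>

lemma group_S_contractions:
  assumes "block P Q (mcnj Q) (mcnj P) \<in> group_S"
  defines "R \<equiv> matrix_inv P"
  obtains m where "0 \<le> m" "m < 1" "\<And>v. norm (bilin v ((mcnj Q ** R) *v v)) \<le> m * (norm v)\<^sup>2"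
    "\<And>v. norm (bilin v ((R ** Q) *v v)) \<le> m * (norm v)\<^sup>2"
proof -
  have R: "P ** R = mat 1" "transpose P ** transpose R = mat 1"
    unfolding R_def using matrix_inv_works[OF group_S_invertible[OF assms(1)]]
    by (simp_all flip: matrix_transpose_mul)
  note S = group_S_adj_sums[OF assms(1), folded R_def]
  obtain m where m: "0 \<le> m" "m < 1" "\<And>v. norm ((mcnj Q ** R) *v v) \<le> m * norm v"
    using strict_contraction[OF S(1) R(1)] by blast
  obtain l where l: "0 \<le> l" "l < 1" "\<And>v. norm (transpose (R ** Q) *v v) \<le> l * norm v"
    using strict_contraction[OF S(2) R(2)] by blast
  have gen: "norm (bilin v w) \<le> max m l * (norm v)\<^sup>2" if "norm w \<le> m * norm v \<or> norm w \<le> l * norm v" for v w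
  proof -
    have "m * norm v \<le> max m l * norm v" "l * norm v \<le> max m l * norm v" by (intro mult_right_mono; simp)+
    hence "norm w \<le> max m l * norm v" using that by linarith
    hence "norm v * norm w \<le> norm v * (max m l * norm v)" by (intro mult_left_mono) auto
    thus ?thesis using norm_bilin_le[of v w] by (simp add: power2_eq_square mult_ac)
  qed
  show ?thesis
  proof (rule that[of "max m l"])
    show "norm (bilin v ((R ** Q) *v v)) \<le> max m l * (norm v)\<^sup>2" for v
      using gen[of "transpose (R ** Q) *v v" v] l(3) by (simp add: bilin_matrix bilin_commute)
  qed (use m l gen in auto)
qed

subsection \<open>The matrix exponential\<close>

abbreviation mpow :: "complex^'m^'m \<Rightarrow> nat \<Rightarrow> complex^'m^'m" where
  "mpow M k \<equiv> ((\<lambda>N. M ** N) ^^ k) (mat 1)"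

lemma matrix_mult_nth: "(A ** B) $ i $ j = (\<Sum>l\<in>UNIV. A $ i $ l * B $ l $ j)"
  by (simp add: matrix_matrix_mult_def)

lemma mpow_Suc_right: "mpow M (Suc k) = mpow M k ** M"
proof (induction k)
  case (Suc k)
  have "mpow M (Suc (Suc k)) = M ** mpow M (Suc k)" by simp
  also have "\<dots> = M ** (mpow M k ** M)" by (simp only: Suc)
  also have "\<dots> = mpow M (Suc k) ** M" by (simp add: matrix_mul_assoc)
  finally show ?case .
qed simp

lemma mpow_scaleR: "mpow (t *\<^sub>R M) k = t ^ k *\<^sub>R mpow M k"
proof (induction k)
  case (Suc k)
  have "mpow (t *\<^sub>R M) (Suc k) = (t *\<^sub>R M) ** (t ^ k *\<^sub>R mpow M k)" by (simp add: Suc)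
  also have "\<dots> = t ^ Suc k *\<^sub>R mpow M (Suc k)"
    by (simp add: vec_eq_iff matrix_mult_nth scaleR_sum_right mult.commute[of t])
  finally show ?case .
qed simp

text \<open>A crude geometric bound suffices, since the factorials make the exponential series
  converge for any ratio.\<close>

lemma norm_mpow_nth_le:
  "norm (mpow M k $ i $ j) \<le> (\<Sum>i\<in>UNIV. \<Sum>j\<in>UNIV. norm (M $ i $ j)) ^ k"
proof (induction k arbitrary: i)
  case 0 show ?case by (simp add: mat_def)
next
  case (Suc k)
  let ?B = "\<Sum>i\<in>UNIV. \<Sum>j\<in>UNIV. norm (M $ i $ j)"
  have "norm (mpow M (Suc k) $ i $ j) \<le> (\<Sum>l\<in>UNIV. norm (M $ i $ l) * norm (mpow M k $ l $ j))"
    by (simp add: matrix_mult_nth) (rule order_trans[OF norm_sum], simp add: norm_mult)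
  also have "\<dots> \<le> (\<Sum>l\<in>UNIV. norm (M $ i $ l) * ?B ^ k)"
    by (intro sum_mono mult_left_mono Suc) auto
  also have "\<dots> = (\<Sum>l\<in>UNIV. norm (M $ i $ l)) * ?B ^ k" by (simp add: sum_distrib_right)
  also have "\<dots> \<le> ?B * ?B ^ k"
    by (intro mult_right_mono member_le_sum) (auto intro!: sum_nonneg zero_le_power)
  finally show ?case by simp
qed

text \<open>With \<open>x\<close> complex, each entry of the exponential becomes an everywhere
  convergent power series, available for termwise differentiation; its restriction to real
  \<open>x\<close> gives \<open>mexp (x *\<^sub>R M)\<close>.\<close>

lemma summable_mpow_nth: "summable (\<lambda>k. (mpow M k $ i $ j / fact k) * x ^ k)"
proof (rule summable_comparison_test', rule summable_exp)
  fix k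
  let ?B = "\<Sum>i\<in>UNIV. \<Sum>j\<in>UNIV. norm (M $ i $ j)"
  show "norm ((mpow M k $ i $ j / fact k) * x ^ k) \<le> inverse (fact k) * (?B * norm x) ^ k"
    using mult_right_mono[OF norm_mpow_nth_le, of "norm x ^ k / fact k"]
    by (simp add: norm_mult norm_divide norm_power power_mult_distrib field_simps)
qed

lemma mexp_nth: "mexp M $ i $ j = (\<Sum>k. mpow M k $ i $ j / fact k)"
proof -
  let ?E = "\<chi> i j. \<Sum>k. mpow M k $ i $ j / fact k"
  have "(\<lambda>k. (1 / fact k) *\<^sub>R mpow M k) sums ?E"
    unfolding sums_def
  proof (intro vec_tendstoI)
    fix i j
    have "(\<lambda>k. mpow M k $ i $ j / fact k) sums (\<Sum>k. mpow M k $ i $ j / fact k)"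
      using summable_mpow_nth[of M i j 1] by (simp add: summable_sums)
    thus "(\<lambda>n. (\<Sum>k<n. (1 / fact k) *\<^sub>R mpow M k) $ i $ j) \<longlonglongrightarrow> ?E $ i $ j"
      by (simp add: sums_def scaleR_conv_of_real[where 'a=complex])
  qed
  hence "mexp M = ?E" unfolding mexp_def by (rule sums_unique[symmetric])
  thus ?thesis by simp
qed

lemma mexp_scaleR_nth:
  "mexp (t *\<^sub>R M) $ i $ j = (\<Sum>k. (mpow M k $ i $ j / fact k) * of_real t ^ k)"
  by (simp add: mexp_nth mpow_scaleR scaleR_conv_of_real[where 'a=complex] mult.commute)

text \<open>Taken entrywise, so that the rules for matrix functions reduce to those for
  complex-valued functions of a real variable.\<close>

definition has_mderiv :: "(real \<Rightarrow> complex^'n^'m) \<Rightarrow> complex^'n^'m \<Rightarrow> real \<Rightarrow> bool" where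
  "has_mderiv A A' t \<longleftrightarrow> (\<forall>i j. ((\<lambda>s. A s $ i $ j) has_vector_derivative A' $ i $ j) (at t))"

text \<open>Termwise differentiation replaces \<open>mpow M k / fact k\<close> by
  \<open>mpow M (Suc k) / fact k\<close>; splitting off the last factor \<open>M\<close> on the
  right restores the original series.\<close>

lemma has_mderiv_mexp: "has_mderiv (\<lambda>t. mexp (t *\<^sub>R M)) (mexp (t *\<^sub>R M) ** M) t"
  unfolding has_mderiv_def
proof (intro allI)
  fix i j
  let ?c = "\<lambda>i j k. mpow M k $ i $ j / fact k"
  have "((\<lambda>x. \<Sum>k. ?c i j k * x ^ k) has_field_derivative (\<Sum>k. diffs (?c i j) k * of_real t ^ k)) (at (of_real t))"
    by (rule termdiffs_strong_converges_everywhere) (rule summable_mpow_nth)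
  hence "((\<lambda>t. mexp (t *\<^sub>R M) $ i $ j) has_vector_derivative (\<Sum>k. diffs (?c i j) k * of_real t ^ k)) (at t)"
    unfolding mexp_scaleR_nth by (rule has_vector_derivative_real_field)
  also have "(\<Sum>k. diffs (?c i j) k * of_real t ^ k)
      = (\<Sum>k. \<Sum>l\<in>UNIV. (?c i l k * of_real t ^ k) * M $ l $ j)"
  proof (rule suminf_cong)
    fix k
    have "diffs (?c i j) k = mpow M (Suc k) $ i $ j / fact k"
      by (simp add: diffs_def del: funpow.simps of_nat_Suc)
    also have "\<dots> = (\<Sum>l\<in>UNIV. ?c i l k * M $ l $ j)"
      unfolding mpow_Suc_right by (simp add: matrix_mult_nth sum_divide_distrib)
    finally show "diffs (?c i j) k * of_real t ^ k = (\<Sum>l\<in>UNIV. (?c i l k * of_real t ^ k) * M $ l $ j)"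
      by (simp add: sum_distrib_right mult.assoc mult.commute[of "of_real t ^ k"])
  qed
  also have "\<dots> = (\<Sum>l\<in>UNIV. (\<Sum>k. (?c i l k * of_real t ^ k) * M $ l $ j))"
    by (rule suminf_sum) (intro summable_mult2 summable_mpow_nth)
  also have "\<dots> = (\<Sum>l\<in>UNIV. (\<Sum>k. ?c i l k * of_real t ^ k) * M $ l $ j)"
    by (intro sum.cong refl suminf_mult2[symmetric] summable_mpow_nth)
  also have "\<dots> = (mexp (t *\<^sub>R M) ** M) $ i $ j"
    by (simp add: matrix_mult_nth mexp_scaleR_nth)
  finally show "((\<lambda>t. mexp (t *\<^sub>R M) $ i $ j) has_vector_derivative (mexp (t *\<^sub>R M) ** M) $ i $ j) (at t)" .
qed

lemma has_mderiv_mult: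
  assumes "has_mderiv A A' t" "has_mderiv B B' t"
  shows "has_mderiv (\<lambda>t. A t ** B t) (A' ** B t + A t ** B') t"
  using assms unfolding has_mderiv_def matrix_matrix_mult_def
  by (auto intro!: derivative_eq_intros simp: sum.distrib add.commute)

lemma has_mderiv_const: "has_mderiv (\<lambda>_. A) 0 t"
  by (simp add: has_mderiv_def)

lemma has_mderiv_adj: "has_mderiv A A' t \<Longrightarrow> has_mderiv (\<lambda>t. adj (A t)) (adj A') t"
  by (auto simp: has_mderiv_def adj_def transpose_def map_matrix_def intro!: has_vector_derivative_cnj)

lemma mexp_0: "mexp (0 *\<^sub>R M) = mat 1"
proof -
  \<comment> \<open>Since \<open>0 ^ 0 = 1\<close>, the term \<open>k = 0\<close> survives.\<close>
  have "(\<Sum>k. (mpow M k $ i $ j / fact k) * 0 ^ k) = mat 1 $ i $ j" for i j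
    by (subst powser_zero) simp
  thus ?thesis by (simp only: vec_eq_iff mexp_scaleR_nth of_real_0) simp
qed

lemma matrix_add_rdistrib: "(A + B) ** C = A ** C + (B ** C :: 'a::semiring_1^'n^'m)"
  by (simp add: vec_eq_iff matrix_matrix_mult_def sum.distrib distrib_right)

text \<open>The derivative of \<open>E t ** K ** adj (E t)\<close> is
  \<open>E t ** (X ** K + K ** adj X) ** adj (E t)\<close>, hence zero, and the value at 0 is
  \<open>K\<close>.\<close>

lemma mexp_preserves_form:
  assumes "X ** K + K ** adj X = 0"
  shows "mexp (t *\<^sub>R X) ** K ** adj (mexp (t *\<^sub>R X)) = K"
proof -
  define E where "E t = mexp (t *\<^sub>R X)" for t :: real
  have "has_mderiv (\<lambda>t. E t ** K ** adj (E t)) (((E t ** X) ** K + E t ** 0) ** adj (E t) + E t ** K ** adj (E t ** X)) t" for t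
    unfolding E_def by (intro has_mderiv_mult has_mderiv_mexp has_mderiv_const has_mderiv_adj)
  moreover have "((E t ** X) ** K + E t ** 0) ** adj (E t) + E t ** K ** adj (E t ** X) = 0" for t
  proof -
    have "((E t ** X) ** K + E t ** 0) ** adj (E t) + E t ** K ** adj (E t ** X)
        = E t ** (X ** K + K ** adj X) ** adj (E t)"
      by (simp add: adj_mult matrix_mul_assoc matrix_add_ldistrib matrix_add_rdistrib)
    thus ?thesis by (simp add: assms)
  qed
  ultimately have d: "has_mderiv (\<lambda>t. E t ** K ** adj (E t)) 0 t" for t by simp
  have "(E t ** K ** adj (E t)) $ i $ j = (E 0 ** K ** adj (E 0)) $ i $ j" for i j
  proof -
    obtain c where "\<And>t. t \<in> UNIV \<Longrightarrow> (E t ** K ** adj (E t)) $ i $ j = c"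
      using has_vector_derivative_zero_constant[of UNIV "\<lambda>t. (E t ** K ** adj (E t)) $ i $ j"] d
      by (auto simp: has_mderiv_def)
    thus ?thesis by simp
  qed
  moreover have "E 0 = mat 1" unfolding E_def by (rule mexp_0)
  ultimately show ?thesis by (simp add: vec_eq_iff E_def[symmetric] adj_def)
qed

section \<open>Conjugation symmetry of block matrices\<close>

fun block_swap :: "'n + 'n \<Rightarrow> 'n + 'n" where
  "block_swap (Inl p) = Inr p" | "block_swap (Inr p) = Inl p"

lemma block_swap_invol [simp]: "block_swap (block_swap i) = i"
  by (cases i) auto

lemma bij_block_swap: "bij block_swap"
  by (rule o_bij[of block_swap]) (auto simp: fun_eq_iff)

text \<open>An entrywise form of the symmetry, suited to induction over matrix powers and to passing
  through the exponential series.\<close>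

lemma conj_block_iff:
  "M = block (upper_left M) (upper_right M) (mcnj (upper_right M)) (mcnj (upper_left M))
    \<longleftrightarrow> (\<forall>i j. M $ block_swap i $ block_swap j = cnj (M $ i $ j))"
    (is "?l \<longleftrightarrow> ?r")
proof
  assume ?l
  hence *: "M $ a $ b = block (upper_left M) (upper_right M) (mcnj (upper_right M)) (mcnj (upper_left M)) $ a $ b" for a b
    by simp
  show ?r
  proof (intro allI)
    fix i j
    show "M $ block_swap i $ block_swap j = cnj (M $ i $ j)"
      unfolding *[of i j] *[of "block_swap i"]
      by (cases i; cases j) (simp_all add: block_def map_matrix_def)
  qed
next
  assume r: ?r
  have "M $ i $ j = block (upper_left M) (upper_right M) (mcnj (upper_right M)) (mcnj (upper_left M)) $ i $ j" for i j
    using r[rule_format, of "block_swap i" "block_swap j"]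
    by (cases i; cases j) (simp_all add: block_def map_matrix_def upper_left_def upper_right_def)
  thus ?l by (simp add: vec_eq_iff)
qed

text \<open>Reindexing the sum in a matrix product by the swap carries the symmetry to all powers.
  As \<open>t\<close> is real, conjugation fixes \<open>t ^ k\<close>, and being continuous it
  passes through the series.\<close>

lemma mexp_conj_block:
  assumes "\<And>i j. M $ block_swap i $ block_swap j = cnj (M $ i $ j)"
  shows "mexp (t *\<^sub>R M) $ block_swap i $ block_swap j = cnj (mexp (t *\<^sub>R M) $ i $ j)"
proof -
  have "mpow M k $ block_swap i $ block_swap j = cnj (mpow M k $ i $ j)" for k i j
  proof (induction k arbitrary: i)
    case 0
    have "block_swap i = block_swap j \<longleftrightarrow> i = j" by (metis block_swap_invol)
    thus ?case by (simp add: mat_def)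
  next
    case (Suc k)
    have "mpow M (Suc k) $ block_swap i $ block_swap j
        = (\<Sum>l\<in>UNIV. M $ block_swap i $ block_swap l * mpow M k $ block_swap l $ block_swap j)"
      by (simp add: matrix_mult_nth)
        (rule sum.reindex_bij_betw[OF bij_block_swap, symmetric])
    thus ?case by (simp add: Suc assms matrix_mult_nth)
  qed
  moreover have "cnj (\<Sum>k. (mpow M k $ i $ j / fact k) * of_real t ^ k) = (\<Sum>k. cnj ((mpow M k $ i $ j / fact k) * of_real t ^ k))"
    by (rule bounded_linear.suminf[OF bounded_linear_cnj summable_mpow_nth])
  ultimately show ?thesis by (simp add: mexp_scaleR_nth)
qed

lemma mexp_algebra_s:
  fixes A B :: "complex^'n^'n"
  assumes "X = block A B (mcnj B) (mcnj A)" "X \<in> algebra_s"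
  defines "E \<equiv> \<lambda>t. mexp (t *\<^sub>R X)"
  shows "E t = block (upper_left (E t)) (upper_right (E t)) (mcnj (upper_right (E t))) (mcnj (upper_left (E t)))"
    and "E t \<in> group_S"
proof -
  have AB: "adj A = - A" "transpose B = B"
    using assms(1,2) by (auto simp: algebra_s_def block_eq_iff)
  have "X = block (upper_left X) (upper_right X) (mcnj (upper_right X)) (mcnj (upper_left X))"
    by (simp add: assms(1))
  hence X: "X $ block_swap i $ block_swap j = cnj (X $ i $ j)" for i j unfolding conj_block_iff by blast
  show blk: "E t = block (upper_left (E t)) (upper_right (E t)) (mcnj (upper_right (E t))) (mcnj (upper_left (E t)))"
    unfolding conj_block_iff E_def by (intro allI mexp_conj_block X)
  \<comment> \<open>For this \<open>K\<close> the infinitesimal relation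
    \<open>X ** K + K ** adj X = 0\<close> encodes exactly \<open>adj A = - A\<close> and
    \<open>transpose B = B\<close>; the upper two blocks of the preserved form are the two relations
    of \<open>group_S\<close>.\<close>
  define K :: "complex^('n+'n)^('n+'n)" where "K = block (mat 1) 0 0 (- mat 1)"
  have tA: "transpose A = - mcnj A" using arg_cong[OF AB(1), of mcnj] by (simp add: mcnj_adj mcnj_uminus)
  have aB: "adj B = mcnj B" using AB(2) by (metis mcnj_transpose)
  have plus: "block A B C D + block A' B' C' D' = block (A + A') (B + B') (C + C') (D + D')"
    for A B C D A' B' C' D' :: "complex^'n^'n"
    by (auto simp: block_def vec_eq_iff split: sum.splits)
  have zero: "block 0 0 0 0 = (0 :: complex^('n+'n)^('n+'n))"
    by (auto simp: block_def vec_eq_iff split: sum.splits)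
  have "X ** K + K ** adj X = 0"
    unfolding assms(1) K_def adj_block block_mult
    by (simp add: plus zero matrix_mul_minus_left matrix_mul_minus_right adj_mcnj AB tA aB)
  hence "E t ** K ** adj (E t) = K" unfolding E_def by (rule mexp_preserves_form)
  define P Q where "P = upper_left (E t)" and "Q = upper_right (E t)"
  note blk' = blk[folded P_def Q_def]
  have "block P Q (mcnj Q) (mcnj P) ** K ** adj (block P Q (mcnj Q) (mcnj P)) = K"
    using \<open>E t ** K ** adj (E t) = K\<close> unfolding blk' .
  hence "P ** adj P - Q ** adj Q = mat 1" "P ** transpose Q - Q ** transpose P = 0"
    unfolding K_def adj_block block_mult
    by (simp_all add: block_eq_iff matrix_mul_minus_left matrix_mul_minus_right adj_mcnj)
  thus "E t \<in> group_S" unfolding blk' group_S_block_iff by simp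
qed

subsection \<open>Metaplectic operators on coherent states\<close>

text \<open>The exponent is linear, so its quadratic rate is 0 and every positive \<open>a\<close>
  will do.\<close>

lemma gauss_bounded_coherent:
  fixes w :: "complex^'n"
  assumes "a > 0" shows "gauss_bounded a (coherent lam w)"
  unfolding coherent_alt[abs_def]
proof (rule gauss_bounded_exp[of 0 _ _ "\<bar>lam\<bar> / 2 * norm w" 0])
  fix z :: "complex^'n"
  have "Re (of_real lam / 2 * bilin (vcnj w) z) \<le> norm (of_real lam / 2 * bilin (vcnj w) z)"
    by (rule complex_Re_le_cmod)
  also have "\<dots> \<le> \<bar>lam\<bar> / 2 * (norm w * norm z)"
    using norm_bilin_le[of "vcnj w" z] by (simp add: norm_mult mult_left_mono)
  finally show "Re (of_real lam / 2 * bilin (vcnj w) z) \<le> 0 * (norm z)\<^sup>2 + \<bar>lam\<bar> / 2 * norm w * norm z + 0"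
    by simp
qed (use assms in auto)

lemma entire_coherent: "entire (coherent lam w)"
proof -
  have "entire (\<lambda>u. exp (of_real lam / 2 * bilin (vcnj w) u))"
    by (rule entire_exp[OF entire_mult[OF entire_const entire_bilin]])
  thus ?thesis by (simp add: coherent_alt[abs_def])
qed

lemma coherent_in_fock: "lam > 0 \<Longrightarrow> coherent lam w \<in> fock lam"
  by (intro fockI entire_coherent gauss_bounded_coherent) auto

lemma fock_inner_coherent_self:
  "lam > 0 \<Longrightarrow> fock_inner lam (coherent lam w) (coherent lam w) = coherent lam w w"
  unfolding fock_inner_def
  by (rule coherent_pairing(2)) (auto intro: entire_coherent gauss_bounded_coherent)

text \<open>Both the kernel as a function of \<open>z\<close> and its conjugate as a function of \<open>w\<close> are of this form.\<close>

lemma gaussian_exponential: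
  fixes M :: "complex^'n^'n" and a :: "complex^'n" and b c :: complex
  assumes "lam > 0" "0 \<le> m" "m < 1" "\<And>v. norm (bilin v (M *v v)) \<le> m * (norm v)\<^sup>2"
  defines "f \<equiv> \<lambda>u. c * exp (of_real lam / 4 * (bilin u (M *v u) + 2 * bilin a u + b))"
  shows "entire f" "gauss_bounded (lam / 4) f"
proof -
  have "entire (\<lambda>u. exp (of_real lam / 4 * (bilin u (M *v u) + 2 * bilin a u + b)))"
    by (rule entire_exp[OF entire_mult[OF entire_const
        entire_add[OF entire_add[OF entire_quadratic entire_mult[OF entire_const entire_bilin]] entire_const]]])
  thus "entire f" unfolding f_def by (rule entire_mult[OF entire_const])
  show "gauss_bounded (lam / 4) f"
  proof (rule gauss_boundedI)
    show "0 \<le> norm c" "0 \<le> lam / 4 * m" "lam / 4 * m < lam / 4" using assms by auto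
    fix u
    let ?e = "bilin u (M *v u) + 2 * bilin a u + b"
    have "Re (of_real lam / 4 * ?e) = lam / 4 * Re ?e" by simp
    also have "\<dots> \<le> lam / 4 * norm ?e"
      using assms(1) by (intro mult_left_mono complex_Re_le_cmod) simp
    also have "norm ?e \<le> norm (bilin u (M *v u)) + norm (2 * bilin a u) + norm b"
      by (meson add_right_mono norm_triangle_ineq order_trans)
    also have "\<dots> \<le> m * (norm u)\<^sup>2 + 2 * (norm a * norm u) + norm b"
      using assms(4)[of u] norm_bilin_le[of a u] by (simp add: norm_mult)
    finally have "Re (of_real lam / 4 * ?e) \<le> lam / 4 * (m * (norm u)\<^sup>2 + 2 * (norm a * norm u) + norm b)"
      using assms(1) by simp
    also have "\<dots> = lam / 4 * m * (norm u)\<^sup>2 + lam / 2 * norm a * norm u + lam / 4 * norm b"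
      by (simp add: algebra_simps)
    finally have "norm (exp (of_real lam / 4 * ?e)) \<le> exp (lam / 4 * m * (norm u)\<^sup>2 + lam / 2 * norm a * norm u + lam / 4 * norm b)"
      by (simp only: norm_exp_eq_Re exp_le_cancel_iff)
    thus "norm (f u) \<le> norm c * exp (lam / 4 * m * (norm u)\<^sup>2 + lam / 2 * norm a * norm u + lam / 4 * norm b)"
      unfolding f_def norm_mult by (intro mult_left_mono) auto
  qed
qed

lemma metaplectic_kernel_block:
  "metaplectic_kernel lam (block P Q C D) z w =
    inverse (csqrt (det P)) * exp (of_real lam / 4 *
      (bilin z ((mcnj Q ** matrix_inv P) *v z) + 2 * bilin (matrix_inv P *v z) (vcnj w)
        - bilin (vcnj w) ((matrix_inv P ** Q) *v vcnj w)))"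
  by (simp add: metaplectic_kernel_def Let_def)

lemma matrix_vector_uminus: "(- M) *v v = - (M *v v :: 'a::ring_1^'n)"
  by (simp add: vec_eq_iff matrix_vector_mult_def sum_negf)

lemma bilin_uminus_right: "bilin a (- b) = - bilin a b"
  by (simp add: bilin_def sum_negf)

lemma metaplectic_coherent:
  fixes P Q :: "complex^'n^'n"
  assumes lam: "lam > 0" and k: "block P Q (mcnj Q) (mcnj P) \<in> group_S"
  defines "b \<equiv> metaplectic_kernel lam (block P Q (mcnj Q) (mcnj P))"
  shows "metaplectic lam (block P Q (mcnj Q) (mcnj P)) (coherent lam w) = (\<lambda>z. b z w)"
    and "coherent lam w \<in> metaplectic_dom lam (block P Q (mcnj Q) (mcnj P))"
proof -
  define R where "R = matrix_inv P"
  obtain m where m: "0 \<le> m" "m < 1" "\<And>v. norm (bilin v ((mcnj Q ** R) *v v)) \<le> m * (norm v)\<^sup>2"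
    "\<And>v. norm (bilin v ((R ** Q) *v v)) \<le> m * (norm v)\<^sup>2"
    using group_S_contractions[OF k] unfolding R_def by blast
  have b: "b z u = inverse (csqrt (det P)) * exp (of_real lam / 4 *
      (bilin z ((mcnj Q ** R) *v z) + 2 * bilin (R *v z) (vcnj u) - bilin (vcnj u) ((R ** Q) *v vcnj u)))" for z u
    unfolding b_def R_def by (rule metaplectic_kernel_block)
  \<comment> \<open>The conjugate kernel in the shape required by
    \<open>gaussian_exponential\<close>: \<open>z\<close> enters only the linear coefficient and the
    constant, and the quadratic form in \<open>u\<close> has matrix
    \<open>- mcnj (R ** Q)\<close>.\<close>
  have cb: "cnj (b z u) = cnj (inverse (csqrt (det P))) * exp (of_real lam / 4 *
      (bilin u ((- mcnj (R ** Q)) *v u) + 2 * bilin (vcnj (R *v z)) u + cnj (bilin z ((mcnj Q ** R) *v z))))" for z u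
    unfolding b by (simp add: exp_cnj cnj_bilin vcnj_mult matrix_vector_uminus bilin_uminus_right algebra_simps)
  have cM: "norm (bilin u ((- mcnj (R ** Q)) *v u)) \<le> m * (norm u)\<^sup>2" for u
  proof -
    have "bilin u ((- mcnj (R ** Q)) *v u) = - cnj (bilin (vcnj u) ((R ** Q) *v vcnj u))"
      by (simp add: cnj_bilin vcnj_mult matrix_vector_uminus bilin_uminus_right)
    thus ?thesis using m(4)[of "vcnj u"] by simp
  qed
  have cbe: "entire (\<lambda>u. cnj (b z u))" "gauss_bounded (lam / 4) (\<lambda>u. cnj (b z u))" for z
    unfolding cb by (rule gaussian_exponential[OF lam m(1,2) cM])+
  have cbe': "gauss_bounded (lam / 2) (\<lambda>u. cnj (b z u))" for z
    by (rule gauss_bounded_mono[OF cbe(2)]) (use lam in simp)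
  \<comment> \<open>The integrand of the operator is the conjugate of a pairing integrand, so the
    integral comes out as \<open>cnj (cnj (b z w))\<close>.\<close>
  have ki: "kernel_integrand lam b (coherent lam w) z u =
      cnj (cnj (b z u) * cnj (coherent lam w u) * of_real (exp (- lam * (norm u)\<^sup>2 / 2)))" for z u
    by (simp add: kernel_integrand_def)
  have int: "integrable (mu lam) (kernel_integrand lam b (coherent lam w) z)" for z
    unfolding ki[abs_def] complex_integrable_cnj
    by (rule coherent_pairing(1)[OF lam cbe(1) cbe'])
  have op: "kernel_op lam b (coherent lam w) = (\<lambda>z. b z w)"
    unfolding kernel_op_def ki Bochner_Integration.integral_cnj
    by (simp only: coherent_pairing(2)[OF lam cbe(1) cbe'] complex_cnj_cnj)
  thus "metaplectic lam (block P Q (mcnj Q) (mcnj P)) (coherent lam w) = (\<lambda>z. b z w)"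
    by (simp add: metaplectic_def b_def)
  \<comment> \<open>The same shape for the first argument: transposing \<open>R\<close> frees
    \<open>z\<close> in the linear term, and the quadratic term in \<open>w\<close> becomes the
    constant.\<close>
  have bz: "b z w = inverse (csqrt (det P)) * exp (of_real lam / 4 *
      (bilin z ((mcnj Q ** R) *v z) + 2 * bilin (transpose R *v vcnj w) z + - bilin (vcnj w) ((R ** Q) *v vcnj w)))" for z
  proof -
    have "bilin (R *v z) (vcnj w) = bilin (transpose R *v vcnj w) z"
      by (simp only: bilin_commute[of "R *v z"] bilin_matrix)
    thus ?thesis unfolding b by simp
  qed
  have "(\<lambda>z. b z w) \<in> fock lam"
    unfolding bz by (intro fockI lam gaussian_exponential[OF lam m(1,2) m(3)])
  thus "coherent lam w \<in> metaplectic_dom lam (block P Q (mcnj Q) (mcnj P))"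
    using int coherent_in_fock[OF lam] by (simp add: metaplectic_dom_def kernel_dom_def b_def[symmetric] op)
qed

subsection \<open>The derived operator\<close>

lemma has_mderiv_nth: "has_mderiv A A' t \<Longrightarrow> ((\<lambda>s. A s $ i $ j) has_vector_derivative A' $ i $ j) (at t)"
  by (simp add: has_mderiv_def)

lemma has_mderiv_mcnj: "has_mderiv A A' t \<Longrightarrow> has_mderiv (\<lambda>t. mcnj (A t)) (mcnj A') t"
  by (auto simp: has_mderiv_def map_matrix_def intro!: has_vector_derivative_cnj)

lemma has_vector_derivative_bilin_matrix:
  assumes "has_mderiv M M' t"
  shows "((\<lambda>s. bilin a (M s *v b)) has_vector_derivative bilin a (M' *v b)) (at t)"
  unfolding bilin_def matrix_vector_mult_def
  by (auto intro!: derivative_eq_intros has_mderiv_nth[OF assms])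

text \<open>A product rule for \<open>g\<close> known merely to be continuous: as
  \<open>f 0 = 0\<close>, the term containing a derivative of \<open>g\<close> does not arise. It
  serves for \<open>(1 - P t) ** R t\<close> while \<open>R\<close> is known only to be
  continuous.\<close>

lemma has_vector_derivative_mult_vanishing:
  fixes f g :: "real \<Rightarrow> complex"
  assumes f: "(f has_vector_derivative f') (at 0)" "f 0 = 0" and g: "isCont g 0"
  shows "((\<lambda>t. f t * g t) has_vector_derivative f' * g 0) (at 0)"
  unfolding has_vector_derivative_def has_derivative_at
proof
  show "bounded_linear (\<lambda>x. x *\<^sub>R (f' * g 0))" by (rule bounded_linear_scaleR_left)
  have "((\<lambda>h. norm (f h - h *\<^sub>R f') / norm h) \<longlongrightarrow> 0) (at 0)"
    using f unfolding has_vector_derivative_def has_derivative_at by simp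
  moreover have g': "(g \<longlongrightarrow> g 0) (at 0)" using g by (simp add: isCont_def)
  ultimately have "((\<lambda>h. norm (f h - h *\<^sub>R f') / norm h * norm (g h) + norm f' * norm (g h - g 0)) \<longlongrightarrow> 0 * norm (g 0) + norm f' * norm (g 0 - g 0)) (at 0)"
    by (intro tendsto_intros)
  hence lim: "((\<lambda>h. norm (f h - h *\<^sub>R f') / norm h * norm (g h) + norm f' * norm (g h - g 0)) \<longlongrightarrow> 0) (at 0)"
    by simp
  have "\<forall>\<^sub>F h in at 0. norm (norm (f (0 + h) * g (0 + h) - f 0 * g 0 - h *\<^sub>R (f' * g 0)) / norm h)
      \<le> norm (f h - h *\<^sub>R f') / norm h * norm (g h) + norm f' * norm (g h - g 0)"
    unfolding eventually_at_filter
  proof (intro always_eventually allI impI)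
    fix h :: real assume h: "h \<noteq> 0"
    \<comment> \<open>After division by \<open>h\<close>, the first summand tends to 0 by
      differentiability of \<open>f\<close> at 0, the second by continuity of
      \<open>g\<close>.\<close>
    have "f h * g h - h *\<^sub>R (f' * g 0) = (f h - h *\<^sub>R f') * g h + h *\<^sub>R (f' * (g h - g 0))"
      by (simp add: algebra_simps)
    hence "norm (f h * g h - h *\<^sub>R (f' * g 0)) \<le> norm (f h - h *\<^sub>R f') * norm (g h) + \<bar>h\<bar> * (norm f' * norm (g h - g 0))"
      using norm_triangle_ineq[of "(f h - h *\<^sub>R f') * g h" "h *\<^sub>R (f' * (g h - g 0))"] by (simp add: norm_mult)
    thus "norm (norm (f (0 + h) * g (0 + h) - f 0 * g 0 - h *\<^sub>R (f' * g 0)) / norm h)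
      \<le> norm (f h - h *\<^sub>R f') / norm h * norm (g h) + norm f' * norm (g h - g 0)"
      using h f(2) by (simp add: field_simps)
  qed
  thus "((\<lambda>h. norm (f (0 + h) * g (0 + h) - f 0 * g 0 - h *\<^sub>R (f' * g 0)) / norm h) \<longlongrightarrow> 0) (at 0)"
    by (rule Lim_null_comparison[OF _ lim])
qed

text \<open>Boundedness of the inverses makes them continuous at \<open>0\<close>, since \<open>R t = 1 + (1 - P t) R t\<close>;
  the same identity then yields the derivative.\<close>

lemma has_mderiv_matrix_inv:
  fixes P :: "real \<Rightarrow> complex^'n^'n"
  assumes P: "has_mderiv P A 0" "P 0 = mat 1" and R: "\<And>t. P t ** R t = mat 1"
    and bound: "\<And>t i j. norm (R t $ i $ j) \<le> c"
  shows "has_mderiv R (- A) 0"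
proof -
  have R0: "R 0 = mat 1" using R[of 0] by (simp add: P)
  have R1: "R t $ i $ j = mat 1 $ i $ j + (\<Sum>l\<in>UNIV. (mat 1 - P t) $ i $ l * R t $ l $ j)" for t i j
  proof -
    have "R t = mat 1 + (mat 1 - P t) ** R t" by (simp add: matrix_mul_diff_left R)
    hence "R t $ i $ j = (mat 1 + (mat 1 - P t) ** R t) $ i $ j" by simp
    thus ?thesis by (simp only: vector_add_component matrix_mult_nth)
  qed
  have dP: "((\<lambda>t. (mat 1 - P t) $ i $ l) has_vector_derivative - A $ i $ l) (at 0)" for i l
    by (auto intro!: derivative_eq_intros has_mderiv_nth[OF P(1)])
  have lim0: "((\<lambda>t. (mat 1 - P t) $ i $ l * R t $ l $ j) \<longlongrightarrow> 0) (at 0)" for i l j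
  proof (rule Lim_null_comparison[OF always_eventually])
    show "\<forall>t. norm ((mat 1 - P t) $ i $ l * R t $ l $ j) \<le> norm ((mat 1 - P t) $ i $ l) * c"
      unfolding norm_mult using bound by (intro allI mult_left_mono) auto
    have "isCont (\<lambda>t. (mat 1 - P t) $ i $ l) 0" by (rule has_vector_derivative_continuous[OF dP])
    hence "((\<lambda>t. norm ((mat 1 - P t) $ i $ l) * c) \<longlongrightarrow> norm ((mat 1 - P 0) $ i $ l) * c) (at 0)"
      unfolding isCont_def by (intro tendsto_mult tendsto_norm tendsto_const)
    thus "((\<lambda>t. norm ((mat 1 - P t) $ i $ l) * c) \<longlongrightarrow> 0) (at 0)" by (simp add: P)
  qed
  have cont: "isCont (\<lambda>t. R t $ i $ j) 0" for i j
  proof -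
    have "((\<lambda>t. mat 1 $ i $ j + (\<Sum>l\<in>UNIV. (mat 1 - P t) $ i $ l * R t $ l $ j)) \<longlongrightarrow> mat 1 $ i $ j + (\<Sum>l\<in>(UNIV::'n set). 0)) (at 0)"
      by (intro tendsto_intros lim0)
    thus ?thesis unfolding isCont_def R0 by (simp only: R1[symmetric] sum.neutral_const add_0_right)
  qed
  show ?thesis
    unfolding has_mderiv_def
  proof (intro allI)
    fix i j
    have "((\<lambda>t. mat 1 $ i $ j + (\<Sum>l\<in>UNIV. (mat 1 - P t) $ i $ l * R t $ l $ j))
        has_vector_derivative 0 + (\<Sum>l\<in>UNIV. - A $ i $ l * R 0 $ l $ j)) (at 0)"
      by (intro has_vector_derivative_add has_vector_derivative_const has_vector_derivative_sum
          has_vector_derivative_mult_vanishing dP cont) (simp add: P)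
    moreover have "0 + (\<Sum>l\<in>UNIV. - A $ i $ l * R 0 $ l $ j) = (- A ** R 0) $ i $ j"
      by (simp add: matrix_mult_nth)
    ultimately show "((\<lambda>t. R t $ i $ j) has_vector_derivative (- A) $ i $ j) (at 0)"
      by (simp only: R1[symmetric] R0 matrix_mul_rid)
  qed
qed

text \<open>At the identity the differentiated Leibniz sum collapses to the identity permutation:
  any other permutation moves at least two points, so removing one factor still leaves an
  off-diagonal zero.\<close>

lemma has_vector_derivative_det:
  fixes P :: "real \<Rightarrow> complex^'n^'n"
  assumes P: "has_mderiv P A 0" "P 0 = mat 1"
  shows "((\<lambda>t. det (P t)) has_vector_derivative trace A) (at 0)"
proof -
  let ?S = "{p. p permutes (UNIV :: 'n set)}"
  have d: "((\<lambda>t. P t $ i $ j) has_derivative (\<lambda>y. y *\<^sub>R A $ i $ j)) (at 0)" for i j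
    using has_mderiv_nth[OF P(1), of i j] by (simp add: has_vector_derivative_def)
  have "((\<lambda>t. det (P t)) has_derivative (\<lambda>y. \<Sum>p\<in>?S. of_int (sign p) *
      (\<Sum>i\<in>UNIV. (y *\<^sub>R A $ i $ p i) * (\<Prod>j\<in>UNIV - {i}. P 0 $ j $ p j)))) (at 0)"
    unfolding det_def by (intro has_derivative_sum has_derivative_mult_right has_derivative_prod d)
  moreover have "(\<Sum>p\<in>?S. of_int (sign p) *
      (\<Sum>i\<in>UNIV. (y *\<^sub>R A $ i $ p i) * (\<Prod>j\<in>UNIV - {i}. P 0 $ j $ p j))) = y *\<^sub>R trace A" for y
  proof -
    have off: "(\<Prod>j\<in>UNIV - {i}. P 0 $ j $ p j) = 0" if p: "p \<in> ?S" "p \<noteq> id" for p and i :: 'n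
    proof -
      have "\<exists>j. j \<noteq> i \<and> p j \<noteq> j"
      proof (rule ccontr)
        assume *: "\<not> ?thesis"
        hence "p i = i" using p(1) by (metis mem_Collect_eq permutes_def)
        hence "p = id" using * by (intro ext) (metis id_apply)
        thus False using p by simp
      qed
      then obtain j where "j \<noteq> i" "j \<noteq> p j" by metis
      hence "j \<in> UNIV - {i}" "P 0 $ j $ p j = 0" by (auto simp: P mat_def)
      thus ?thesis by (intro prod_zero) auto
    qed
    have "(\<Sum>p\<in>?S. of_int (sign p) *
        (\<Sum>i\<in>UNIV. (y *\<^sub>R A $ i $ p i) * (\<Prod>j\<in>UNIV - {i}. P 0 $ j $ p j)))
      = (\<Sum>p\<in>{id}. of_int (sign p) *
        (\<Sum>i\<in>UNIV. (y *\<^sub>R A $ i $ p i) * (\<Prod>j\<in>UNIV - {i}. P 0 $ j $ p j)))"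
      by (rule sum.mono_neutral_right) (auto simp: off permutes_id finite_permutations)
    also have "\<dots> = y *\<^sub>R trace A"
      by (simp add: P mat_def trace_def scaleR_sum_right sign_id)
    finally show ?thesis .
  qed
  ultimately show ?thesis by (simp add: has_vector_derivative_def)
qed

text \<open>The isometry makes every column of \<open>R\<close> have norm at most 1. Along a curve
  in the group this bounds the inverses uniformly.\<close>

lemma norm_entry_le_of_adj_sum:
  assumes "adj N ** N + adj R ** R = mat 1"
  shows "norm (R $ i $ j) \<le> 1"
proof -
  have "R $ i $ j = (R *v axis j 1) $ i"
    by (simp add: matrix_vector_mult_def axis_def if_distrib cong: if_cong)
  also have "norm \<dots> \<le> norm (R *v axis j 1)" by (rule Finite_Cartesian_Product.norm_nth_le)
  also have "\<dots> \<le> 1"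
  proof (rule power2_le_imp_le)
    have "(cmod (axis j 1 $ i))\<^sup>2 = (if i = j then 1 else 0)" for i by (simp add: axis_def)
    hence "(norm (axis j (1 :: complex)))\<^sup>2 = 1" by (simp add: norm_vec_def L2_set_def)
    thus "(norm (R *v axis j 1))\<^sup>2 \<le> 1\<^sup>2"
      using norm_sq_of_adj_sum[OF assms, of "axis j 1"] by (smt (verit) one_power2 zero_le_power2)
  qed simp
  finally show ?thesis .
qed

text \<open>The points \<open>z\<close> and \<open>w\<close> are independent here, because the
  derivative must be known as a function of \<open>z\<close> to place it in the Fock space.\<close>

lemma metaplectic_mexp_derivative:
  fixes A B :: "complex^'n^'n"
  assumes lam: "lam > 0" and X: "X = block A B (mcnj B) (mcnj A)" "X \<in> algebra_s"
  shows "((\<lambda>t. metaplectic lam (mexp (t *\<^sub>R X)) (coherent lam w) z) has_vector_derivative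
      (- (1 / 2) * trace A + of_real lam / 4 * (bilin z (mcnj B *v z)
        - 2 * bilin (A *v z) (vcnj w) - bilin (vcnj w) (B *v vcnj w))) * coherent lam w z) (at 0)"
    and "coherent lam w \<in> metaplectic_dom lam (mexp (t *\<^sub>R X))"
proof -
  define E where "E t = mexp (t *\<^sub>R X)" for t :: real
  define P where "P t = upper_left (E t)" for t
  define Q where "Q t = upper_right (E t)" for t
  define R where "R t = matrix_inv (P t)" for t
  have Eb: "E t = block (P t) (Q t) (mcnj (Q t)) (mcnj (P t))" for t
    unfolding P_def Q_def E_def by (rule mexp_algebra_s(1)[OF X])
  have G: "block (P t) (Q t) (mcnj (Q t)) (mcnj (P t)) \<in> group_S" for t
    using mexp_algebra_s(2)[OF X, of t] by (simp only: Eb[symmetric] E_def)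
  show "coherent lam w \<in> metaplectic_dom lam (mexp (t *\<^sub>R X))"
    using metaplectic_coherent(2)[OF lam G] by (simp only: Eb[symmetric] E_def)
  have E0: "E 0 = mat 1" unfolding E_def by (rule mexp_0)
  have P0: "P 0 = mat 1" and Q0: "Q 0 = 0" by (simp_all add: P_def Q_def E0 block_one)
  have dE: "has_mderiv E X 0"
    using has_mderiv_mexp[of X 0] unfolding E_def mexp_0 by simp
  have dP: "has_mderiv P A 0" and dQ: "has_mderiv Q B 0"
    using dE by (auto simp: has_mderiv_def P_def Q_def upper_left_def upper_right_def X(1) block_def split: sum.splits)
  have PR: "P t ** R t = mat 1" for t
    unfolding R_def by (rule matrix_inv_works(1)[OF group_S_invertible[OF G]])
  have R0: "R 0 = mat 1" using PR[of 0] by (simp add: P0)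
  have dR: "has_mderiv R (- A) 0"
    using norm_entry_le_of_adj_sum[OF group_S_adj_sums(1)[OF G]]
    by (intro has_mderiv_matrix_inv[OF dP P0 PR, of 1]) (simp add: R_def)
  \<comment> \<open>As \<open>Q 0 = 0\<close> and \<open>R 0 = mat 1\<close>, the derivative of
    \<open>R\<close> drops out of both products and only that of \<open>Q\<close> remains.\<close>
  have d1: "has_mderiv (\<lambda>t. mcnj (Q t) ** R t) (mcnj B) 0"
    using has_mderiv_mult[OF has_mderiv_mcnj[OF dQ] dR] by (simp add: R0 Q0)
  have d2: "has_mderiv (\<lambda>t. R t ** Q t) B 0"
    using has_mderiv_mult[OF dR dQ] by (simp add: R0 Q0)
  define ph where "ph t = bilin z ((mcnj (Q t) ** R t) *v z) + 2 * bilin (vcnj w) (R t *v z)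
      - bilin (vcnj w) ((R t ** Q t) *v vcnj w)" for t
  define ph' where "ph' = bilin z (mcnj B *v z) - 2 * bilin (vcnj w) (A *v z) - bilin (vcnj w) (B *v vcnj w)"
  have dph: "(ph has_vector_derivative ph') (at 0)"
    unfolding ph_def ph'_def
    by (auto intro!: derivative_eq_intros has_vector_derivative_bilin_matrix[OF d1]
        has_vector_derivative_bilin_matrix[OF d2] has_vector_derivative_bilin_matrix[OF dR]
        simp: matrix_vector_uminus bilin_uminus_right)
  \<comment> \<open>Multiplied by \<open>lam / 4\<close> this is the exponent of the coherent state,
    the source of the common factor \<open>coherent lam w z\<close>.\<close>
  have ph0: "ph 0 = 2 * bilin (vcnj w) z" by (simp add: ph_def R0 Q0)
  have dexp: "((\<lambda>t. exp (of_real lam / 4 * ph t)) has_vector_derivative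
      ph' * (of_real lam / 4 * coherent lam w z)) (at 0)"
  proof -
    have "((\<lambda>x. exp (of_real lam / 4 * x)) has_field_derivative of_real lam / 4 * exp (of_real lam / 4 * ph 0)) (at (ph 0))"
      by (auto intro!: derivative_eq_intros)
    from field_vector_diff_chain_at[OF dph this] show ?thesis
      by (simp add: o_def ph0 coherent_alt)
  qed
  have ddet: "((\<lambda>t. inverse (csqrt (det (P t)))) has_vector_derivative trace A * - (1 / 2)) (at 0)"
  proof -
    \<comment> \<open>\<open>det (P 0) = 1\<close> lies off the cut of the principal root, so the
      usual derivative of the inverse square root applies, with value \<open>- (1 / 2)\<close> at
      1.\<close>
    have "((\<lambda>x. inverse (csqrt x)) has_field_derivative - (1 / 2)) (at (det (P 0)))"
      by (auto intro!: derivative_eq_intros simp: P0)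
    from field_vector_diff_chain_at[OF has_vector_derivative_det[OF dP P0] this] show ?thesis
      by (simp add: o_def)
  qed
  have "metaplectic lam (E t) (coherent lam w) z = inverse (csqrt (det (P t))) * exp (of_real lam / 4 * ph t)" for t
    unfolding Eb metaplectic_coherent(1)[OF lam G] metaplectic_kernel_block ph_def R_def[symmetric]
    by (simp add: bilin_commute[of _ "vcnj w"])
  moreover have "((\<lambda>t. inverse (csqrt (det (P t))) * exp (of_real lam / 4 * ph t)) has_vector_derivative
      inverse (csqrt (det (P 0))) * (ph' * (of_real lam / 4 * coherent lam w z))
      + trace A * - (1 / 2) * exp (of_real lam / 4 * ph 0)) (at 0)"
    by (rule has_vector_derivative_mult[OF ddet dexp])
  moreover have "inverse (csqrt (det (P 0))) * (ph' * (of_real lam / 4 * coherent lam w z))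
      + trace A * - (1 / 2) * exp (of_real lam / 4 * ph 0)
      = (- (1 / 2) * trace A + of_real lam / 4 * (bilin z (mcnj B *v z)
        - 2 * bilin (A *v z) (vcnj w) - bilin (vcnj w) (B *v vcnj w))) * coherent lam w z"
    by (simp add: P0 ph0 ph'_def coherent_alt bilin_commute[of _ "vcnj w"] algebra_simps)
  ultimately show "((\<lambda>t. metaplectic lam (mexp (t *\<^sub>R X)) (coherent lam w) z) has_vector_derivative
      (- (1 / 2) * trace A + of_real lam / 4 * (bilin z (mcnj B *v z)
        - 2 * bilin (A *v z) (vcnj w) - bilin (vcnj w) (B *v vcnj w))) * coherent lam w z) (at 0)"
    by (simp only: E_def)
qed

text \<open>The rate \<open>lam / 4\<close> is split evenly: the quadratic polynomial and the
  coherent state each stay below the rate \<open>lam / 8\<close>.\<close>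

lemma polynomial_coherent_in_fock:
  fixes A B :: "complex^'n^'n"
  assumes lam: "lam > 0"
  shows "(\<lambda>z. (c + d * (bilin z (B *v z) - 2 * bilin (A *v z) a - b)) * coherent lam w z) \<in> fock lam"
proof (rule fockI[OF lam])
  let ?p = "\<lambda>z. c + d * (bilin z (B *v z) + (- 2 * bilin (transpose A *v a) z + - b))"
  have eq: "c + d * (bilin z (B *v z) - 2 * bilin (A *v z) a - b) = ?p z" for z
    by (simp only: bilin_commute[of "A *v z"] bilin_matrix) (simp add: algebra_simps)
  have "entire ?p"
    by (rule entire_add[OF entire_const entire_mult[OF entire_const entire_add[OF entire_quadratic
        entire_add[OF entire_mult[OF entire_const entire_bilin] entire_const]]]])
  thus "entire (\<lambda>z. (c + d * (bilin z (B *v z) - 2 * bilin (A *v z) a - b)) * coherent lam w z)"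
    unfolding eq by (rule entire_mult) (rule entire_coherent)
  obtain K where K: "\<And>v. norm (B *v v) \<le> K * norm v" using norm_matrix_vector_bound[of B] by blast
  let ?v = "transpose A *v a"
  have "gauss_bounded (lam / 8) ?p"
  proof (rule gauss_bounded_poly)
    fix z
    have "norm (?p z) \<le> norm c + norm d * (norm (bilin z (B *v z)) + (norm (- 2 * bilin ?v z) + norm (- b)))"
      by (rule order_trans[OF norm_triangle_ineq], rule add_left_mono, subst norm_mult, rule mult_left_mono,
          rule order_trans[OF norm_triangle_ineq], rule add_left_mono, rule norm_triangle_ineq) simp
    also have "\<dots> \<le> norm c + norm d * (norm z * (K * norm z) + (2 * (norm ?v * norm z) + norm b))"
    proof (intro add_left_mono mult_left_mono add_mono)
      show "norm (bilin z (B *v z)) \<le> norm z * (K * norm z)"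
        by (rule order_trans[OF norm_bilin_le]) (intro mult_left_mono K norm_ge_zero)
      show "norm (- 2 * bilin ?v z) \<le> 2 * (norm ?v * norm z)"
        using norm_bilin_le[of ?v z] by (simp add: norm_mult)
    qed auto
    also have "\<dots> = norm c + norm d * norm b + norm d * (2 * norm ?v) * norm z + norm d * K * (norm z)\<^sup>2"
      by (simp add: algebra_simps power2_eq_square)
    finally show "norm (?p z) \<le> norm c + norm d * norm b + norm d * (2 * norm ?v) * norm z + norm d * K * (norm z)\<^sup>2" .
  qed (use lam in simp)
  from gauss_bounded_mult[OF this gauss_bounded_coherent[of "lam / 8" lam w]] lam
  show "gauss_bounded (lam / 4) (\<lambda>z. (c + d * (bilin z (B *v z) - 2 * bilin (A *v z) a - b)) * coherent lam w z)"
    unfolding eq by simp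
qed

theorem proposition6p6:
  fixes lam :: real
  assumes "lam > 0"
  shows
    "(\<forall>(P :: complex^'n^'n) Q k.
        k = block P Q (mcnj Q) (mcnj P) \<and> k \<in> group_S \<longrightarrow>
        (\<forall>z. coherent lam z \<in> metaplectic_dom lam k \<and>
          berezin lam (metaplectic lam k) z =
            inverse (csqrt (det P)) *
            exp (of_real lam / 4 *
              (bilin z ((mcnj Q ** matrix_inv P) *v z)
               + 2 * bilin (vcnj z) ((matrix_inv P - mat 1) *v z)
               - bilin (vcnj z) ((matrix_inv P ** Q) *v vcnj z)))))
     \<and>
     (\<forall>(A :: complex^'n^'n) B X.
        X = block A B (mcnj B) (mcnj A) \<and> X \<in> algebra_s \<longrightarrow>
        (\<forall>z. coherent lam z \<in> metaplectic_diff_dom lam X \<and>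
          berezin lam (metaplectic_diff lam X) z =
            - (1 / 2) * trace A
            + of_real lam / 4 * bilin z (mcnj B *v z)
            - of_real lam / 2 * bilin (A *v z) (vcnj z)
            - of_real lam / 4 * bilin (vcnj z) (B *v vcnj z)))"
proof (intro conjI allI impI; elim conjE)
  fix P Q :: "complex^'n^'n" and k z
  assume k: "k = block P Q (mcnj Q) (mcnj P)" "k \<in> group_S"
  note G = k(2)[unfolded k(1)]
  show "coherent lam z \<in> metaplectic_dom lam k"
    unfolding k(1) by (rule metaplectic_coherent(2)[OF assms G])
  let ?R = "matrix_inv P"
  let ?e = "bilin z ((mcnj Q ** ?R) *v z) + 2 * bilin (?R *v z) (vcnj z) - bilin (vcnj z) ((?R ** Q) *v vcnj z)"
  have "berezin lam (metaplectic lam k) z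
      = inverse (csqrt (det P)) * (exp (of_real lam / 4 * ?e) / coherent lam z z)"
    unfolding berezin_def k(1) metaplectic_coherent(1)[OF assms G] fock_inner_coherent_self[OF assms]
      metaplectic_kernel_block by simp
  also have "exp (of_real lam / 4 * ?e) / coherent lam z z
      = exp (of_real lam / 4 * ?e - of_real lam / 2 * bilin (vcnj z) z)"
    by (simp add: coherent_alt exp_diff)
  \<comment> \<open>Dividing by the squared norm of the coherent state subtracts
    \<open>lam / 2\<close> times \<open>bilin (vcnj z) z\<close>, which turns the inverse of
    \<open>P\<close> into the inverse minus the identity.\<close>
  also have "of_real lam / 4 * ?e - of_real lam / 2 * bilin (vcnj z) z
      = of_real lam / 4 * (bilin z ((mcnj Q ** ?R) *v z)
         + 2 * bilin (vcnj z) ((?R - mat 1) *v z) - bilin (vcnj z) ((?R ** Q) *v vcnj z))"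
    by (simp add: matrix_vector_mult_diff_rdistrib bilin_diff_right bilin_commute[of _ "vcnj z"] algebra_simps)
  finally show "berezin lam (metaplectic lam k) z = inverse (csqrt (det P)) *
      exp (of_real lam / 4 * (bilin z ((mcnj Q ** ?R) *v z)
         + 2 * bilin (vcnj z) ((?R - mat 1) *v z) - bilin (vcnj z) ((?R ** Q) *v vcnj z)))" .
next
  fix A B :: "complex^'n^'n" and X z
  assume X: "X = block A B (mcnj B) (mcnj A)" "X \<in> algebra_s"
  note D = metaplectic_mexp_derivative(1)[OF assms X, of z]
  have diff: "metaplectic_diff lam X (coherent lam z) = (\<lambda>u. (- (1 / 2) * trace A + of_real lam / 4 *
      (bilin u (mcnj B *v u) - 2 * bilin (A *v u) (vcnj z) - bilin (vcnj z) (B *v vcnj z))) * coherent lam z u)"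
    unfolding metaplectic_diff_def by (intro ext vector_derivative_at D)
  have "(\<lambda>t. metaplectic lam (mexp (t *\<^sub>R X)) (coherent lam z) u) differentiable (at 0)" for u
    using D by (rule differentiableI_vector)
  moreover have fock: "metaplectic_diff lam X (coherent lam z) \<in> fock lam"
    unfolding diff by (rule polynomial_coherent_in_fock[OF assms])
  ultimately show "coherent lam z \<in> metaplectic_diff_dom lam X"
    unfolding metaplectic_diff_dom_def
    using metaplectic_mexp_derivative(2)[OF assms X] coherent_in_fock[OF assms]
      fock by simp
  \<comment> \<open>The squared norm of the coherent state equals \<open>coherent lam z z\<close>,
    the factor already carried by the derived operator's image, so it cancels and the polynomial is
    the symbol.\<close>
  have "coherent lam z z \<noteq> 0" by (simp add: coherent_alt)
  thus "berezin lam (metaplectic_diff lam X) z =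
      - (1 / 2) * trace A + of_real lam / 4 * bilin z (mcnj B *v z)
      - of_real lam / 2 * bilin (A *v z) (vcnj z) - of_real lam / 4 * bilin (vcnj z) (B *v vcnj z)"
    unfolding berezin_def diff fock_inner_coherent_self[OF assms] by (simp add: field_simps)
qed

end
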